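(* Let $\mathcal{E}$ be an elementary topos and let $k$ be the Boolean (resp. De Morgan) topology on $\mathcal{E}$. Then for any weakly open local operator $j$ on $\mathcal{E}$, $j\geq k$ if and only if $\mathbf{sh}_{j}(\mathcal{E})$ is Boolean (resp. satisfies De Morgan's law).
   Context: For a local operator (Lawvere–Tierney topology) $j$ on $\mathcal{E}$, $\mathbf{sh}_{j}(\mathcal{E})$ denotes the topos of $j$-sheaves and $a_{j}:\mathcal{E}\to\mathbf{sh}_{j}(\mathcal{E})$ the associated sheaf functor; a subobject is $j$-dense if its $j$-closure is the maximal subobject (equivalently, $a_j$ sends it to an isomorphism). Local operators are ordered pointwise, so that $j\ge k$ if and only if every $k$-dense monomorphism is $j$-dense, equivalently $\mathbf{sh}_{j}(\mathcal{E})\subseteq\mathbf{sh}_{k}(\mathcal{E})$. The local operator $j$ is weakly open if $a_{j}$ preserves the pseudocomplementation $\neg$ of subobjects. The Boolean topology on $\mathcal{E}$ is the double negation topology $\neg\neg$; equivalently, it is the smallest local operator for which all subobjects of the form $m\vee\neg m$ ($m$ a subobject in $\mathcal{E}$) are dense. The De Morgan topology on $\mathcal{E}$ is the smallest local operator for which all subobjects of the form $\neg m\vee\neg\neg m$ ($m$ a subobject in $\mathcal{E}$) are dense. A topos is Boolean (resp. satisfies De Morgan's law) if $m\vee\neg m$ (resp. $\neg m\vee\neg\neg m$) is the maximal subobject for every subobject $m$ of every object. *)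

theory Defs
  imports "HOL-Algebra.Lattice"
begin

section \<open>Categories\<close>

text \<open>As in the algebra library, a category is a record of data restricted to carrier sets; only the
  members of \<open>obj\<close> and \<open>arr\<close> count as objects and arrows. \<open>g \<cdot> f\<close> is ``\<open>g\<close> after \<open>f\<close>'',
  meaningful when \<open>src g = tgt f\<close>.\<close>

record ('o, 'a) cat =
  obj :: "'o set"
  arr :: "'a set"
  src :: "'a \<Rightarrow> 'o"
  tgt :: "'a \<Rightarrow> 'o"
  idt :: "'o \<Rightarrow> 'a"
  cmp :: "'a \<Rightarrow> 'a \<Rightarrow> 'a"  (infixr \<open>\<cdot>\<index>\<close> 75)

definition Hom :: "('o, 'a) cat \<Rightarrow> 'o \<Rightarrow> 'o \<Rightarrow> 'a set" where
  "Hom C A B = {f \<in> arr C. src C f = A \<and> tgt C f = B}"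

locale category =
  fixes C :: "('o, 'a) cat" (structure)
  assumes src_obj: "f \<in> arr C \<Longrightarrow> src C f \<in> obj C"
    and tgt_obj: "f \<in> arr C \<Longrightarrow> tgt C f \<in> obj C"
    and idt_Hom: "A \<in> obj C \<Longrightarrow> idt C A \<in> Hom C A A"
    and cmp_Hom: "f \<in> Hom C A B \<Longrightarrow> g \<in> Hom C B D \<Longrightarrow> g \<cdot> f \<in> Hom C A D"
    and cmp_idt_right: "f \<in> Hom C A B \<Longrightarrow> f \<cdot> idt C A = f"
    and cmp_idt_left: "f \<in> Hom C A B \<Longrightarrow> idt C B \<cdot> f = f"
    and cmp_assoc:
      "f \<in> Hom C A B \<Longrightarrow> g \<in> Hom C B D \<Longrightarrow> h \<in> Hom C D F \<Longrightarrow> (h \<cdot> g) \<cdot> f = h \<cdot> (g \<cdot> f)"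

definition full_subcat :: "('o, 'a) cat \<Rightarrow> 'o set \<Rightarrow> ('o, 'a) cat" where
  "full_subcat C S =
     C\<lparr>obj := obj C \<inter> S, arr := {f \<in> arr C. src C f \<in> S \<and> tgt C f \<in> S}\<rparr>"

definition is_functor ::
    "('o, 'a) cat \<Rightarrow> ('p, 'b) cat \<Rightarrow> ('o \<Rightarrow> 'p) \<Rightarrow> ('a \<Rightarrow> 'b) \<Rightarrow> bool" where
  "is_functor C D Fo Fa \<longleftrightarrow>
     category C \<and> category D \<and>
     (\<forall>A\<in>obj C. Fo A \<in> obj D \<and> Fa (idt C A) = idt D (Fo A)) \<and>
     (\<forall>f\<in>arr C. Fa f \<in> Hom D (Fo (src C f)) (Fo (tgt C f))) \<and>
     (\<forall>f\<in>arr C. \<forall>g\<in>arr C. src C g = tgt C f \<longrightarrow> Fa (g \<cdot>\<^bsub>C\<^esub> f) = Fa g \<cdot>\<^bsub>D\<^esub> Fa f)"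

definition monic :: "('o, 'a) cat \<Rightarrow> 'a \<Rightarrow> bool" where
  "monic C m \<longleftrightarrow> m \<in> arr C \<and>
     (\<forall>f\<in>arr C. \<forall>g\<in>arr C. src C f = src C g \<and> tgt C f = src C m \<and> tgt C g = src C m \<and>
        m \<cdot>\<^bsub>C\<^esub> f = m \<cdot>\<^bsub>C\<^esub> g \<longrightarrow> f = g)"

section \<open>Limits and exponentials\<close>

definition is_terminal :: "('o, 'a) cat \<Rightarrow> 'o \<Rightarrow> bool" where
  "is_terminal C T \<longleftrightarrow> T \<in> obj C \<and> (\<forall>X\<in>obj C. \<exists>!f. f \<in> Hom C X T)"

definition is_product :: "('o, 'a) cat \<Rightarrow> 'o \<Rightarrow> 'o \<Rightarrow> 'a \<Rightarrow> 'a \<Rightarrow> bool" where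
  "is_product C A B p q \<longleftrightarrow>
     p \<in> arr C \<and> q \<in> arr C \<and> src C p = src C q \<and> tgt C p = A \<and> tgt C q = B \<and>
     (\<forall>X\<in>obj C. \<forall>f\<in>Hom C X A. \<forall>g\<in>Hom C X B.
        \<exists>!h. h \<in> Hom C X (src C p) \<and> p \<cdot>\<^bsub>C\<^esub> h = f \<and> q \<cdot>\<^bsub>C\<^esub> h = g)"

definition is_equalizer :: "('o, 'a) cat \<Rightarrow> 'a \<Rightarrow> 'a \<Rightarrow> 'a \<Rightarrow> bool" where
  "is_equalizer C f g e \<longleftrightarrow>
     e \<in> arr C \<and> tgt C e = src C f \<and> f \<cdot>\<^bsub>C\<^esub> e = g \<cdot>\<^bsub>C\<^esub> e \<and>
     (\<forall>x\<in>arr C. tgt C x = src C f \<and> f \<cdot>\<^bsub>C\<^esub> x = g \<cdot>\<^bsub>C\<^esub> x \<longrightarrow>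
        (\<exists>!h. h \<in> Hom C (src C x) (src C e) \<and> e \<cdot>\<^bsub>C\<^esub> h = x))"

text \<open>\<open>p\<close> and \<open>q\<close> are the projections of the pullback of the cospan formed by \<open>f\<close> and \<open>g\<close>, so
  \<open>f \<cdot> p = g \<cdot> q\<close>.\<close>

definition is_pullback :: "('o, 'a) cat \<Rightarrow> 'a \<Rightarrow> 'a \<Rightarrow> 'a \<Rightarrow> 'a \<Rightarrow> bool" where
  "is_pullback C f g p q \<longleftrightarrow>
     f \<in> arr C \<and> g \<in> arr C \<and> p \<in> arr C \<and> q \<in> arr C \<and>
     tgt C f = tgt C g \<and> src C p = src C q \<and> tgt C p = src C f \<and> tgt C q = src C g \<and>
     f \<cdot>\<^bsub>C\<^esub> p = g \<cdot>\<^bsub>C\<^esub> q \<and>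
     (\<forall>X\<in>obj C. \<forall>x\<in>Hom C X (src C f). \<forall>y\<in>Hom C X (src C g).
        f \<cdot>\<^bsub>C\<^esub> x = g \<cdot>\<^bsub>C\<^esub> y \<longrightarrow>
        (\<exists>!h. h \<in> Hom C X (src C p) \<and> p \<cdot>\<^bsub>C\<^esub> h = x \<and> q \<cdot>\<^bsub>C\<^esub> h = y))"

definition has_finite_limits :: "('o, 'a) cat \<Rightarrow> bool" where
  "has_finite_limits C \<longleftrightarrow>
     (\<exists>T. is_terminal C T) \<and>
     (\<forall>A\<in>obj C. \<forall>B\<in>obj C. \<exists>p q. is_product C A B p q) \<and>
     (\<forall>f\<in>arr C. \<forall>g\<in>arr C. src C f = src C g \<and> tgt C f = tgt C g \<longrightarrow> (\<exists>e. is_equalizer C f g e))"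

text \<open>A choice of binary products. No notion below depends on it, products being unique
  up to isomorphism.\<close>

definition prod_cone :: "('o, 'a) cat \<Rightarrow> 'o \<Rightarrow> 'o \<Rightarrow> 'a \<times> 'a" where
  "prod_cone C A B = (SOME (p, q). is_product C A B p q)"

definition pr1 :: "('o, 'a) cat \<Rightarrow> 'o \<Rightarrow> 'o \<Rightarrow> 'a" where
  "pr1 C A B = fst (prod_cone C A B)"

definition pr2 :: "('o, 'a) cat \<Rightarrow> 'o \<Rightarrow> 'o \<Rightarrow> 'a" where
  "pr2 C A B = snd (prod_cone C A B)"

definition prod_obj :: "('o, 'a) cat \<Rightarrow> 'o \<Rightarrow> 'o \<Rightarrow> 'o" where
  "prod_obj C A B = src C (pr1 C A B)"

definition pairing :: "('o, 'a) cat \<Rightarrow> 'a \<Rightarrow> 'a \<Rightarrow> 'a" where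
  "pairing C f g =
     (THE h. h \<in> Hom C (src C f) (prod_obj C (tgt C f) (tgt C g)) \<and>
        pr1 C (tgt C f) (tgt C g) \<cdot>\<^bsub>C\<^esub> h = f \<and> pr2 C (tgt C f) (tgt C g) \<cdot>\<^bsub>C\<^esub> h = g)"

definition prod_arr :: "('o, 'a) cat \<Rightarrow> 'a \<Rightarrow> 'a \<Rightarrow> 'a" where
  "prod_arr C f g =
     pairing C (f \<cdot>\<^bsub>C\<^esub> pr1 C (src C f) (src C g)) (g \<cdot>\<^bsub>C\<^esub> pr2 C (src C f) (src C g))"

definition has_exponentials :: "('o, 'a) cat \<Rightarrow> bool" where
  "has_exponentials C \<longleftrightarrow>
     (\<forall>A\<in>obj C. \<forall>B\<in>obj C. \<exists>P\<in>obj C. \<exists>ev\<in>Hom C (prod_obj C P A) B.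
        \<forall>X\<in>obj C. \<forall>f\<in>Hom C (prod_obj C X A) B.
          \<exists>!g. g \<in> Hom C X P \<and> ev \<cdot>\<^bsub>C\<^esub> prod_arr C g (idt C A) = f)"

section \<open>Subobjects\<close>

text \<open>Subobjects of \<open>X\<close> are represented by monomorphisms into \<open>X\<close>, preordered by factorisation;
  the setoid equality \<open>.=\<close> of this order is equality of subobjects. Meets, joins, \<open>\<top>\<close> and \<open>\<bottom>\<close>
  are those of the library, hence representatives determined up to \<open>.=\<close>.\<close>

definition Sub :: "('o, 'a) cat \<Rightarrow> 'o \<Rightarrow> 'a gorder" where
  "Sub C X =
     (let le' = (\<lambda>m n. \<exists>h\<in>Hom C (src C m) (src C n). n \<cdot>\<^bsub>C\<^esub> h = m)
      in \<lparr>carrier = {m. monic C m \<and> tgt C m = X},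
          eq = (\<lambda>m n. le' m n \<and> le' n m),
          le = le'\<rparr>)"

definition pcomp :: "'b gorder \<Rightarrow> 'b \<Rightarrow> 'b"  (\<open>\<sim>\<index> _\<close> [81] 80) where
  "\<sim>\<^bsub>L\<^esub> x = (SOME y. greatest L y {z \<in> carrier L. z \<sqinter>\<^bsub>L\<^esub> x .=\<^bsub>L\<^esub> \<bottom>\<^bsub>L\<^esub>})"

definition is_boolean :: "('o, 'a) cat \<Rightarrow> bool" where
  "is_boolean C \<longleftrightarrow>
     (\<forall>X\<in>obj C. \<forall>m\<in>carrier (Sub C X).
        m \<squnion>\<^bsub>Sub C X\<^esub> (\<sim>\<^bsub>Sub C X\<^esub> m) .=\<^bsub>Sub C X\<^esub> \<top>\<^bsub>Sub C X\<^esub>)"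

definition is_de_morgan :: "('o, 'a) cat \<Rightarrow> bool" where
  "is_de_morgan C \<longleftrightarrow>
     (\<forall>X\<in>obj C. \<forall>m\<in>carrier (Sub C X).
        (\<sim>\<^bsub>Sub C X\<^esub> m) \<squnion>\<^bsub>Sub C X\<^esub> (\<sim>\<^bsub>Sub C X\<^esub> (\<sim>\<^bsub>Sub C X\<^esub> m)) .=\<^bsub>Sub C X\<^esub> \<top>\<^bsub>Sub C X\<^esub>)"

section \<open>Elementary toposes\<close>

text \<open>A subobject classifier is given by its generic subobject \<open>t : 1 \<rightarrow> \<Omega>\<close>, so that
  \<open>\<Omega>\<close> is \<open>tgt E t\<close>.\<close>

definition classifies :: "('o, 'a) cat \<Rightarrow> 'a \<Rightarrow> 'a \<Rightarrow> 'a \<Rightarrow> bool" where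
  "classifies E t \<chi> m \<longleftrightarrow> (\<exists>u. is_pullback E \<chi> t m u)"

definition subobject_classifier :: "('o, 'a) cat \<Rightarrow> 'a \<Rightarrow> bool" where
  "subobject_classifier E t \<longleftrightarrow>
     t \<in> arr E \<and> is_terminal E (src E t) \<and>
     (\<forall>m. monic E m \<longrightarrow> (\<exists>!\<chi>. \<chi> \<in> Hom E (tgt E m) (tgt E t) \<and> classifies E t \<chi> m))"

definition elementary_topos :: "('o, 'a) cat \<Rightarrow> bool" where
  "elementary_topos E \<longleftrightarrow>
     category E \<and> has_finite_limits E \<and> has_exponentials E \<and> (\<exists>t. subobject_classifier E t)"

definition chr :: "('o, 'a) cat \<Rightarrow> 'a \<Rightarrow> 'a \<Rightarrow> 'a" where
  "chr E t m = (THE \<chi>. \<chi> \<in> Hom E (tgt E m) (tgt E t) \<and> classifies E t \<chi> m)"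

definition omega_and :: "('o, 'a) cat \<Rightarrow> 'a \<Rightarrow> 'a" where
  "omega_and E t = chr E t (pairing E t t)"

definition omega_false :: "('o, 'a) cat \<Rightarrow> 'a \<Rightarrow> 'a" where
  "omega_false E t = chr E t \<bottom>\<^bsub>Sub E (src E t)\<^esub>"

definition omega_not :: "('o, 'a) cat \<Rightarrow> 'a \<Rightarrow> 'a" where
  "omega_not E t = chr E t (omega_false E t)"

section \<open>Local operators and sheaves\<close>

definition local_operator :: "('o, 'a) cat \<Rightarrow> 'a \<Rightarrow> 'a \<Rightarrow> bool" where
  "local_operator E t j \<longleftrightarrow>
     j \<in> Hom E (tgt E t) (tgt E t) \<and>
     j \<cdot>\<^bsub>E\<^esub> t = t \<and>
     j \<cdot>\<^bsub>E\<^esub> j = j \<and>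
     j \<cdot>\<^bsub>E\<^esub> omega_and E t = omega_and E t \<cdot>\<^bsub>E\<^esub> prod_arr E j j"

text \<open>The pointwise order on endomorphisms of \<open>\<Omega>\<close>, with respect to the internal meet-semilattice
  structure of \<open>\<Omega>\<close>: \<open>k \<le> j\<close> iff \<open>k \<and> j = k\<close>.\<close>

definition lop_le :: "('o, 'a) cat \<Rightarrow> 'a \<Rightarrow> 'a \<Rightarrow> 'a \<Rightarrow> bool" where
  "lop_le E t k j \<longleftrightarrow> omega_and E t \<cdot>\<^bsub>E\<^esub> pairing E k j = k"

definition jclosure :: "('o, 'a) cat \<Rightarrow> 'a \<Rightarrow> 'a \<Rightarrow> 'a \<Rightarrow> 'a" where
  "jclosure E t j m =
     (SOME c. c \<in> carrier (Sub E (tgt E m)) \<and> classifies E t (j \<cdot>\<^bsub>E\<^esub> chr E t m) c)"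

definition jdense :: "('o, 'a) cat \<Rightarrow> 'a \<Rightarrow> 'a \<Rightarrow> 'a \<Rightarrow> bool" where
  "jdense E t j m \<longleftrightarrow>
     monic E m \<and> jclosure E t j m .=\<^bsub>Sub E (tgt E m)\<^esub> \<top>\<^bsub>Sub E (tgt E m)\<^esub>"

definition is_sheaf :: "('o, 'a) cat \<Rightarrow> 'a \<Rightarrow> 'a \<Rightarrow> 'o \<Rightarrow> bool" where
  "is_sheaf E t j F \<longleftrightarrow> F \<in> obj E \<and>
     (\<forall>m f. jdense E t j m \<and> f \<in> Hom E (src E m) F \<longrightarrow>
        (\<exists>!g. g \<in> Hom E (tgt E m) F \<and> g \<cdot>\<^bsub>E\<^esub> m = f))"

definition sh :: "('o, 'a) cat \<Rightarrow> 'a \<Rightarrow> 'a \<Rightarrow> ('o, 'a) cat" where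
  "sh E t j = full_subcat E {F. is_sheaf E t j F}"

text \<open>The associated sheaf functor is the left adjoint of the inclusion of sheaves; the adjunction
  is given by its unit \<open>\<eta>\<close>, a natural transformation whose components are universal
  arrows to the inclusion.\<close>

definition associated_sheaf_functor ::
    "('o, 'a) cat \<Rightarrow> 'a \<Rightarrow> 'a \<Rightarrow> ('o \<Rightarrow> 'o) \<Rightarrow> ('a \<Rightarrow> 'a) \<Rightarrow> ('o \<Rightarrow> 'a) \<Rightarrow> bool" where
  "associated_sheaf_functor E t j ao aa \<eta> \<longleftrightarrow>
     is_functor E (sh E t j) ao aa \<and>
     (\<forall>X\<in>obj E. \<eta> X \<in> Hom E X (ao X)) \<and>
     (\<forall>f\<in>arr E. aa f \<cdot>\<^bsub>E\<^esub> \<eta> (src E f) = \<eta> (tgt E f) \<cdot>\<^bsub>E\<^esub> f) \<and>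
     (\<forall>X\<in>obj E. \<forall>F\<in>obj (sh E t j). \<forall>f\<in>Hom E X F.
        \<exists>!g. g \<in> Hom (sh E t j) (ao X) F \<and> g \<cdot>\<^bsub>E\<^esub> \<eta> X = f)"

text \<open>An associated sheaf functor exists for every local operator and is unique up to natural
  isomorphism, so it does not matter which one is used here.\<close>

definition weakly_open :: "('o, 'a) cat \<Rightarrow> 'a \<Rightarrow> 'a \<Rightarrow> bool" where
  "weakly_open E t j \<longleftrightarrow>
     (\<exists>ao aa \<eta>. associated_sheaf_functor E t j ao aa \<eta> \<and>
        (\<forall>X\<in>obj E. \<forall>m\<in>carrier (Sub E X).
           aa (\<sim>\<^bsub>Sub E X\<^esub> m) .=\<^bsub>Sub (sh E t j) (ao X)\<^esub> \<sim>\<^bsub>Sub (sh E t j) (ao X)\<^esub> (aa m)))"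

section \<open>The Boolean and De Morgan topologies\<close>

definition boolean_topology :: "('o, 'a) cat \<Rightarrow> 'a \<Rightarrow> 'a" where
  "boolean_topology E t = omega_not E t \<cdot>\<^bsub>E\<^esub> omega_not E t"

definition de_morgan_dense :: "('o, 'a) cat \<Rightarrow> 'a \<Rightarrow> 'a \<Rightarrow> bool" where
  "de_morgan_dense E t j \<longleftrightarrow>
     (\<forall>X\<in>obj E. \<forall>m\<in>carrier (Sub E X).
        jdense E t j ((\<sim>\<^bsub>Sub E X\<^esub> m) \<squnion>\<^bsub>Sub E X\<^esub> (\<sim>\<^bsub>Sub E X\<^esub> (\<sim>\<^bsub>Sub E X\<^esub> m))))"

definition is_de_morgan_topology :: "('o, 'a) cat \<Rightarrow> 'a \<Rightarrow> 'a \<Rightarrow> bool" where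
  "is_de_morgan_topology E t k \<longleftrightarrow>
     local_operator E t k \<and> de_morgan_dense E t k \<and>
     (\<forall>k'. local_operator E t k' \<and> de_morgan_dense E t k' \<longrightarrow> lop_le E t k k')"

end

theory Submission
  imports Defs
begin

text \<open>Subobjects of \<open>X\<close> are the same as predicates \<open>p : X \<rightarrow> \<Omega>\<close>, the pseudocomplement \<open>\<not>p\<close> included, and
\<open>j\<close>-closure is composition with \<open>j\<close>. The closed predicates (\<open>j \<cdot> p = p\<close>) on a sheaf \<open>F\<close> are its
subobjects in the topos of sheaves; there the bottom is \<open>j\<bottom>\<close>, the join is \<open>j(p \<or> q)\<close> and the
pseudocomplement is \<open>\<not>\<^sub>j p = (p \<Rightarrow> j\<bottom>)\<close>. Pulling back along the unit \<open>\<eta> : X \<rightarrow> aX\<close> is a bijection from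
the closed predicates on \<open>aX\<close> to those on \<open>X\<close>, because \<open>\<Omega>\<^sub>j\<close> is a sheaf, and it sends the
subobject \<open>a(m)\<close> to the closure of \<open>m\<close> (\<open>chr_aa\<close>). Weak openness therefore says exactly that
\<open>j(\<not>p) = \<not>\<^sub>j(jp)\<close> for all predicates \<open>p\<close> on all objects (\<open>j_neg\<close>), and the rest is algebra:

\<^item> If \<open>\<not>\<not> \<le> j\<close>, then \<open>p \<or> \<not>p\<close> is \<open>j\<close>-dense, being \<open>\<not>\<not>\<close>-dense, and it lies below \<open>p \<or> \<not>\<^sub>j p\<close>.

\<^item> If sheaves are Boolean, then transporting along \<open>\<eta>\<close> gives \<open>j(jp \<or> j\<not>p) = \<top>\<close> for every \<open>p\<close>; but
  both \<open>jp\<close> and \<open>j\<not>p\<close> lie below the closed predicate \<open>\<not>\<not>p \<Rightarrow> jp\<close>, so that \<open>\<not>\<not>p \<le> jp\<close>.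

\<^item> In the same way sheaves satisfy De Morgan's law iff \<open>\<not>p \<or> \<not>\<not>p\<close> is \<open>j\<close>-dense for all \<open>p\<close>, and
  \<open>k\<close> is the least local operator with this property.

The only properties of the associated sheaf functor that are given are those of a left adjoint, so
its preservation of monomorphisms has to be proved (\<open>aa_monic\<close>): each sheaf embeds in a sheaf that
is injective with respect to all monomorphisms, namely \<open>\<Omega>\<^sub>j\<^bsup>F\<^esup>\<close>. Neither joins nor a bottom
subobject are part of the data of a topos either; \<open>\<bottom>\<close> and \<open>\<or>\<close> are defined by their second-order
encodings, and all connectives are handled through their truth at generalised elements
\<open>f : Y \<rightarrow> X\<close>, which makes their stability under substitution evident.\<close>

section \<open>Lattice operations read off an order isomorphism\<close>

text \<open>The operations of a preorder are chosen representatives, about which nothing is known until their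
existence is established. A surjection \<open>\<phi>\<close> onto a partial order \<open>P\<close> that preserves and reflects the
order provides both the existence and the value of the operations.\<close>

locale order_presentation =
  fixes L :: "'b gorder" (structure) and \<phi> :: "'b \<Rightarrow> 'p" and P :: "'p set" and R :: "'p \<Rightarrow> 'p \<Rightarrow> bool"
  assumes image: "\<phi> ` carrier L = P"
    and le_iff: "x \<in> carrier L \<Longrightarrow> y \<in> carrier L \<Longrightarrow> x \<sqsubseteq> y \<longleftrightarrow> R (\<phi> x) (\<phi> y)"
    and eq_iff: "x \<in> carrier L \<Longrightarrow> y \<in> carrier L \<Longrightarrow> x .= y \<longleftrightarrow> \<phi> x = \<phi> y"
    and antisym: "p \<in> P \<Longrightarrow> q \<in> P \<Longrightarrow> R p q \<Longrightarrow> R q p \<Longrightarrow> p = q"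
begin

lemma image_in: "x \<in> carrier L \<Longrightarrow> \<phi> x \<in> P"
  using image by blast

lemma surj: assumes "p \<in> P" obtains x where "x \<in> carrier L" "\<phi> x = p"
  using assms image by blast

lemma some_least:
  assumes A: "A = {x \<in> carrier L. \<phi> x \<in> B}" and p: "p \<in> P" "p \<in> B" and le: "\<And>q. q \<in> P \<Longrightarrow> q \<in> B \<Longrightarrow> R p q"
  shows "(SOME x. least L x A) \<in> carrier L" "\<phi> (SOME x. least L x A) = p"
proof -
  obtain x where x: "x \<in> carrier L" "\<phi> x = p" using surj p by blast
  have "least L x A"
    unfolding least_def using A x p le by (auto simp: le_iff image_in)
  then have l: "least L (SOME x. least L x A) A" by (rule someI)
  let ?s = "SOME x. least L x A"
  have s: "?s \<in> carrier L" "\<phi> ?s \<in> B" using l A by (auto simp: least_def)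
  have "?s \<sqsubseteq> x" using l x A p by (auto simp: least_def)
  then have "R (\<phi> ?s) p" using le_iff[OF s(1) x(1)] x by simp
  then show "?s \<in> carrier L" "\<phi> ?s = p"
    using s p le[of "\<phi> ?s"] image_in antisym[of "\<phi> ?s" p] by auto
qed

lemma some_greatest:
  assumes A: "A = {x \<in> carrier L. \<phi> x \<in> B}" and p: "p \<in> P" "p \<in> B" and le: "\<And>q. q \<in> P \<Longrightarrow> q \<in> B \<Longrightarrow> R q p"
  shows "(SOME x. greatest L x A) \<in> carrier L" "\<phi> (SOME x. greatest L x A) = p"
proof -
  obtain x where x: "x \<in> carrier L" "\<phi> x = p" using surj p by blast
  have "greatest L x A"
    unfolding greatest_def using A x p le by (auto simp: le_iff image_in)
  then have l: "greatest L (SOME x. greatest L x A) A" by (rule someI)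
  let ?s = "SOME x. greatest L x A"
  have s: "?s \<in> carrier L" "\<phi> ?s \<in> B" using l A by (auto simp: greatest_def)
  have "x \<sqsubseteq> ?s" using l x A p by (auto simp: greatest_def)
  then have "R p (\<phi> ?s)" using le_iff[OF x(1) s(1)] x by simp
  then show "?s \<in> carrier L" "\<phi> ?s = p"
    using s p le[of "\<phi> ?s"] image_in antisym[of "\<phi> ?s" p] by auto
qed

lemma bottom:
  assumes "b \<in> P" "\<And>q. q \<in> P \<Longrightarrow> R b q"
  shows "\<bottom> \<in> carrier L" "\<phi> \<bottom> = b"
  using some_least[of "carrier L" UNIV b] assms by (auto simp: bottom_def)

lemma top:
  assumes "b \<in> P" "\<And>q. q \<in> P \<Longrightarrow> R q b"
  shows "\<top> \<in> carrier L" "\<phi> \<top> = b"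
  using some_greatest[of "carrier L" UNIV b] assms by (auto simp: top_def)

lemma join:
  assumes x: "x \<in> carrier L" and y: "y \<in> carrier L"
    and s: "s \<in> P" "R (\<phi> x) s" "R (\<phi> y) s"
    and least: "\<And>q. q \<in> P \<Longrightarrow> R (\<phi> x) q \<Longrightarrow> R (\<phi> y) q \<Longrightarrow> R s q"
  shows "x \<squnion> y \<in> carrier L" "\<phi> (x \<squnion> y) = s"
proof -
  have U: "Upper L {x, y} = {z \<in> carrier L. \<phi> z \<in> {q. R (\<phi> x) q \<and> R (\<phi> y) q}}"
    using x y by (auto simp: Upper_def le_iff)
  show "x \<squnion> y \<in> carrier L" "\<phi> (x \<squnion> y) = s"
    unfolding join_def sup_def using some_least[OF U, of s] s least by auto
qed

lemma meet:
  assumes x: "x \<in> carrier L" and y: "y \<in> carrier L"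
    and s: "s \<in> P" "R s (\<phi> x)" "R s (\<phi> y)"
    and greatest: "\<And>q. q \<in> P \<Longrightarrow> R q (\<phi> x) \<Longrightarrow> R q (\<phi> y) \<Longrightarrow> R q s"
  shows "x \<sqinter> y \<in> carrier L" "\<phi> (x \<sqinter> y) = s"
proof -
  have U: "Lower L {x, y} = {z \<in> carrier L. \<phi> z \<in> {q. R q (\<phi> x) \<and> R q (\<phi> y)}}"
    using x y by (auto simp: Lower_def le_iff)
  show "x \<sqinter> y \<in> carrier L" "\<phi> (x \<sqinter> y) = s"
    unfolding meet_def inf_def using some_greatest[OF U, of s] s greatest by auto
qed

text \<open>The pseudocomplement is characterised through the meets with \<open>x\<close>, so a function \<open>m\<close> computing
these meets in \<open>P\<close> has to be supplied.\<close>

lemma pcomp: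
  assumes x: "x \<in> carrier L"
    and b: "b \<in> P" "\<And>q. q \<in> P \<Longrightarrow> R b q"
    and m: "\<And>p. p \<in> P \<Longrightarrow> m p \<in> P \<and> R (m p) p \<and> R (m p) (\<phi> x)"
      "\<And>p q. p \<in> P \<Longrightarrow> q \<in> P \<Longrightarrow> R q p \<Longrightarrow> R q (\<phi> x) \<Longrightarrow> R q (m p)"
    and n: "n \<in> P" "\<And>p. p \<in> P \<Longrightarrow> m p = b \<longleftrightarrow> R p n" "R n n"
  shows "\<sim> x \<in> carrier L" "\<phi> (\<sim> x) = n"
proof -
  have "{z \<in> carrier L. z \<sqinter> x .= \<bottom>} = {z \<in> carrier L. \<phi> z \<in> {p. R p n}}"
  proof -
    have "z \<sqinter> x .= \<bottom> \<longleftrightarrow> R (\<phi> z) n" if z: "z \<in> carrier L" for z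
    proof -
      note mt = meet[OF z x, of "m (\<phi> z)"]
      have "z \<sqinter> x \<in> carrier L" "\<phi> (z \<sqinter> x) = m (\<phi> z)"
        using m image_in[OF z] by (auto intro!: mt)
      then show ?thesis using bottom[OF b] n(2)[OF image_in[OF z]] by (simp add: eq_iff)
    qed
    then show ?thesis by auto
  qed
  from some_greatest[OF this, of n] show "\<sim> x \<in> carrier L" "\<phi> (\<sim> x) = n"
    using n by (auto simp: pcomp_def)
qed

end

section \<open>Elementary toposes\<close>

lemma in_Hom [simp]: "f \<in> Hom C A B \<longleftrightarrow> f \<in> arr C \<and> src C f = A \<and> tgt C f = B"
  by (auto simp: Hom_def)

locale topos =
  fixes E :: "('o, 'a) cat" (structure) and t :: 'a
  assumes elementary: "elementary_topos E"
    and classifier: "subobject_classifier E t"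
begin

abbreviation \<Omega> :: 'o where "\<Omega> \<equiv> tgt E t"
abbreviation one :: 'o where "one \<equiv> src E t"

sublocale category E
  using elementary by (simp add: elementary_topos_def)

declare src_obj [simp] tgt_obj [simp]

lemma idt_simps [simp]:
  assumes "A \<in> obj E"
  shows "idt E A \<in> arr E" "src E (idt E A) = A" "tgt E (idt E A) = A"
  using idt_Hom[OF assms] by auto

lemma cmp_simps [simp]:
  assumes "f \<in> arr E" "g \<in> arr E" "src E g = tgt E f"
  shows "g \<cdot> f \<in> arr E" "src E (g \<cdot> f) = src E f" "tgt E (g \<cdot> f) = tgt E g"
  using cmp_Hom[of f "src E f" "tgt E f" g "tgt E g"] assms by auto

lemma idt_cmp [simp]:
  assumes "f \<in> arr E" "A = tgt E f"
  shows "idt E A \<cdot> f = f"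
  using cmp_idt_left[of f "src E f" A] assms by auto

lemma cmp_idt [simp]:
  assumes "f \<in> arr E" "A = src E f"
  shows "f \<cdot> idt E A = f"
  using cmp_idt_right[of f A "tgt E f"] assms by auto

lemma assoc [simp]:
  assumes "f \<in> arr E" "g \<in> arr E" "h \<in> arr E" "src E g = tgt E f" "src E h = tgt E g"
  shows "(h \<cdot> g) \<cdot> f = h \<cdot> (g \<cdot> f)"
  using cmp_assoc[of f "src E f" "tgt E f" g "tgt E g" h "tgt E h"] assms by auto

text \<open>Composites are normalised to the right, so an equation between composites cannot be applied inside
a longer one by rewriting; this rule does it.\<close>

lemma cmp_extend:
  assumes "h \<cdot> g = k" "f \<in> arr E" "g \<in> arr E" "h \<in> arr E" "src E g = tgt E f" "src E h = tgt E g"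
  shows "h \<cdot> g \<cdot> f = k \<cdot> f"
  unfolding assms(1)[symmetric] by (rule assoc[symmetric]; fact)

subsection \<open>Products\<close>

lemma is_product_pr:
  assumes "A \<in> obj E" "B \<in> obj E"
  shows "is_product E A B (pr1 E A B) (pr2 E A B)"
proof -
  have "\<exists>p q. is_product E A B p q"
    using elementary assms by (simp add: elementary_topos_def has_finite_limits_def)
  then have "\<exists>pq. case pq of (p, q) \<Rightarrow> is_product E A B p q" by auto
  from someI_ex[OF this] show ?thesis
    by (simp add: pr1_def pr2_def prod_cone_def case_prod_unfold)
qed

lemma pr_simps [simp]:
  assumes "A \<in> obj E" "B \<in> obj E"
  shows "pr1 E A B \<in> arr E" "pr2 E A B \<in> arr E"
    "src E (pr1 E A B) = prod_obj E A B" "src E (pr2 E A B) = prod_obj E A B"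
    "tgt E (pr1 E A B) = A" "tgt E (pr2 E A B) = B" "prod_obj E A B \<in> obj E"
  using is_product_pr[OF assms] by (auto simp: is_product_def prod_obj_def src_obj)

lemma pairing_ex1:
  assumes "f \<in> arr E" "g \<in> arr E" "src E f = src E g"
  shows "\<exists>!h. h \<in> Hom E (src E f) (prod_obj E (tgt E f) (tgt E g)) \<and>
    pr1 E (tgt E f) (tgt E g) \<cdot> h = f \<and> pr2 E (tgt E f) (tgt E g) \<cdot> h = g"
proof -
  have "is_product E (tgt E f) (tgt E g) (pr1 E (tgt E f) (tgt E g)) (pr2 E (tgt E f) (tgt E g))"
    using assms by (simp add: is_product_pr)
  then have "\<forall>x\<in>Hom E (src E f) (tgt E f). \<forall>y\<in>Hom E (src E f) (tgt E g).
      \<exists>!h. h \<in> Hom E (src E f) (src E (pr1 E (tgt E f) (tgt E g))) \<and>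
        pr1 E (tgt E f) (tgt E g) \<cdot> h = x \<and> pr2 E (tgt E f) (tgt E g) \<cdot> h = y"
    unfolding is_product_def using assms src_obj by blast
  moreover have "f \<in> Hom E (src E f) (tgt E f)" "g \<in> Hom E (src E f) (tgt E g)"
    using assms by auto
  ultimately show ?thesis using assms unfolding prod_obj_def by blast
qed

lemma pairing_simps [simp]:
  assumes "f \<in> arr E" "g \<in> arr E" "src E f = src E g"
  shows "pairing E f g \<in> arr E" "src E (pairing E f g) = src E g"
    "tgt E (pairing E f g) = prod_obj E (tgt E f) (tgt E g)"
    "A = tgt E f \<Longrightarrow> B = tgt E g \<Longrightarrow> pr1 E A B \<cdot> pairing E f g = f"
    "A = tgt E f \<Longrightarrow> B = tgt E g \<Longrightarrow> pr2 E A B \<cdot> pairing E f g = g"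
  using theI'[OF pairing_ex1[OF assms], folded pairing_def] assms by auto

lemma pairing_eqI:
  assumes "h \<in> arr E" "h' \<in> arr E" "src E h = src E h'" "A \<in> obj E" "B \<in> obj E"
    "tgt E h = prod_obj E A B" "tgt E h' = prod_obj E A B"
    "pr1 E A B \<cdot> h = pr1 E A B \<cdot> h'" "pr2 E A B \<cdot> h = pr2 E A B \<cdot> h'"
  shows "h = h'"
  using pairing_ex1[of "pr1 E A B \<cdot> h" "pr2 E A B \<cdot> h"] assms by auto

lemma pairing_cmp [simp]:
  assumes "f \<in> arr E" "g \<in> arr E" "src E f = src E g" "h \<in> arr E" "tgt E h = src E g"
  shows "pairing E f g \<cdot> h = pairing E (f \<cdot> h) (g \<cdot> h)"
proof (rule pairing_eqI[where A = "tgt E f" and B = "tgt E g"])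
  show "pr1 E (tgt E f) (tgt E g) \<cdot> (pairing E f g \<cdot> h) =
      pr1 E (tgt E f) (tgt E g) \<cdot> pairing E (f \<cdot> h) (g \<cdot> h)"
    using assms by (simp add: assoc[symmetric] del: assoc)
  show "pr2 E (tgt E f) (tgt E g) \<cdot> (pairing E f g \<cdot> h) =
      pr2 E (tgt E f) (tgt E g) \<cdot> pairing E (f \<cdot> h) (g \<cdot> h)"
    using assms by (simp add: assoc[symmetric] del: assoc)
qed (use assms in simp_all)

lemma pairing_pr [simp]:
  assumes "h \<in> arr E" "tgt E h = prod_obj E A B" "A \<in> obj E" "B \<in> obj E"
  shows "pairing E (pr1 E A B \<cdot> h) (pr2 E A B \<cdot> h) = h"
  by (rule pairing_eqI[where A = A and B = B]) (use assms in simp_all)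

lemma prod_arr_simps [simp]:
  assumes "f \<in> arr E" "g \<in> arr E"
  shows "prod_arr E f g \<in> arr E" "src E (prod_arr E f g) = prod_obj E (src E f) (src E g)"
    "tgt E (prod_arr E f g) = prod_obj E (tgt E f) (tgt E g)"
  using assms by (simp_all add: prod_arr_def)

lemma prod_arr_cmp [simp]:
  assumes "f \<in> arr E" "g \<in> arr E" "h \<in> arr E" "tgt E h = prod_obj E (src E f) (src E g)"
  shows "prod_arr E f g \<cdot> h =
    pairing E (f \<cdot> pr1 E (src E f) (src E g) \<cdot> h) (g \<cdot> pr2 E (src E f) (src E g) \<cdot> h)"
  using assms by (simp add: prod_arr_def)

subsection \<open>Truth values of generalised elements\<close>

lemma t_simps [simp]: "t \<in> arr E"
  using classifier by (simp add: subobject_classifier_def)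

lemma bang_ex1: "X \<in> obj E \<Longrightarrow> \<exists>!u. u \<in> Hom E X one"
  using classifier unfolding subobject_classifier_def is_terminal_def by blast

definition bang :: "'o \<Rightarrow> 'a" where
  "bang X = (THE u. u \<in> Hom E X one)"

definition tru :: "'o \<Rightarrow> 'a" where
  "tru X = t \<cdot> bang X"

lemma bang_simps [simp]:
  assumes "X \<in> obj E"
  shows "bang X \<in> arr E" "src E (bang X) = X" "tgt E (bang X) = one"
  using theI'[OF bang_ex1[OF assms]] by (auto simp: bang_def)

lemma bang_unique: "u \<in> arr E \<Longrightarrow> tgt E u = one \<Longrightarrow> bang (src E u) = u"
  using bang_ex1[of "src E u"] bang_simps[of "src E u"] by auto

lemma tru_simps [simp]:
  assumes "X \<in> obj E"
  shows "tru X \<in> arr E" "src E (tru X) = X" "tgt E (tru X) = \<Omega>"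
  using assms by (simp_all add: tru_def)

lemma t_cmp: "u \<in> arr E \<Longrightarrow> tgt E u = one \<Longrightarrow> t \<cdot> u = tru (src E u)"
  by (simp add: tru_def bang_unique)

lemma tru_cmp [simp]: "f \<in> arr E \<Longrightarrow> X = tgt E f \<Longrightarrow> tru X \<cdot> f = tru (src E f)"
  using t_cmp[of "bang X \<cdot> f"] by (simp add: tru_def bang_unique)

text \<open>Kripke-Joyal semantics restricted to truth: \<open>holds p f\<close> says that the predicate \<open>p\<close> on \<open>X\<close> is
true at the generalised element \<open>f : Y \<rightarrow> X\<close>.\<close>

definition holds :: "'a \<Rightarrow> 'a \<Rightarrow> bool" where
  "holds p f \<longleftrightarrow> p \<cdot> f = tru (src E f)"

lemma holds_cmp [simp]:
  assumes "p \<in> arr E" "f \<in> arr E" "g \<in> arr E" "src E p = tgt E f" "src E f = tgt E g"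
  shows "holds (p \<cdot> f) g \<longleftrightarrow> holds p (f \<cdot> g)"
  using assms by (simp add: holds_def)

lemma holds_mono:
  assumes "p \<in> arr E" "f \<in> arr E" "g \<in> arr E" "src E p = tgt E f" "src E f = tgt E g"
    "tgt E p = \<Omega>" "holds p f"
  shows "holds p (f \<cdot> g)"
proof -
  have "(p \<cdot> f) \<cdot> g = tru (src E g)" using assms by (simp del: assoc add: holds_def)
  then show ?thesis using assms by (simp add: holds_def)
qed

lemma holds_tru [simp]: "f \<in> arr E \<Longrightarrow> X = tgt E f \<Longrightarrow> holds (tru X) f"
  by (simp add: holds_def)

definition factors :: "'a \<Rightarrow> 'a \<Rightarrow> bool" where
  "factors f m \<longleftrightarrow> (\<exists>h\<in>arr E. src E h = src E f \<and> tgt E h = src E m \<and> m \<cdot> h = f)"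

lemma monicD:
  assumes "monic E m" "f \<in> arr E" "g \<in> arr E" "src E f = src E g"
    "tgt E f = src E m" "tgt E g = src E m" "m \<cdot> f = m \<cdot> g"
  shows "f = g"
  using assms by (auto simp: monic_def)

lemma monic_arr [simp]: "monic E m \<Longrightarrow> m \<in> arr E"
  by (simp add: monic_def)

lemma monicI:
  assumes "m \<in> arr E"
    "\<And>f g. f \<in> arr E \<Longrightarrow> g \<in> arr E \<Longrightarrow> src E f = src E g \<Longrightarrow> tgt E f = src E m \<Longrightarrow>
      tgt E g = src E m \<Longrightarrow> m \<cdot> f = m \<cdot> g \<Longrightarrow> f = g"
  shows "monic E m"
  unfolding monic_def using assms by blast

lemma factors_refl: "m \<in> arr E \<Longrightarrow> factors m m"
  unfolding factors_def by (intro bexI[of _ "idt E (src E m)"]) auto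

lemma factors_trans: "factors f m \<Longrightarrow> factors m n \<Longrightarrow> n \<in> arr E \<Longrightarrow> m \<in> arr E \<Longrightarrow> factors f n"
  unfolding factors_def
proof (elim bexE conjE)
  fix h h' assume h: "h \<in> arr E" "src E h = src E f" "tgt E h = src E m" "m \<cdot> h = f"
    "h' \<in> arr E" "src E h' = src E m" "tgt E h' = src E n" "n \<cdot> h' = m" and mn: "n \<in> arr E" "m \<in> arr E"
  have "n \<cdot> h' \<cdot> h = f" using cmp_extend[OF h(8), of h] h mn by simp
  then show "\<exists>h\<in>arr E. src E h = src E f \<and> tgt E h = src E n \<and> n \<cdot> h = f"
    using h(1-3,5-7) mn by (intro bexI[of _ "h' \<cdot> h"]) simp_all
qed

lemma monic_cmp:
  assumes "monic E m" "monic E n" "tgt E n = src E m"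
  shows "monic E (m \<cdot> n)"
proof (rule monicI)
  fix f g assume "f \<in> arr E" "g \<in> arr E" "src E f = src E g" "tgt E f = src E (m \<cdot> n)"
     "tgt E g = src E (m \<cdot> n)" "(m \<cdot> n) \<cdot> f = (m \<cdot> n) \<cdot> g"
  then show "f = g" using assms monicD[OF assms(1), of "n \<cdot> f" "n \<cdot> g"] monicD[OF assms(2), of f g] by simp
qed (use assms in auto)

text \<open>The pullback square over \<open>t\<close> says no more than this because its second projection goes to a terminal
object and is therefore determined.\<close>

lemma classifies_iff:
  assumes m: "monic E m" and p: "p \<in> arr E" "src E p = tgt E m" "tgt E p = \<Omega>"
  shows "classifies E t p m \<longleftrightarrow>
    (\<forall>f\<in>arr E. tgt E f = tgt E m \<longrightarrow> (holds p f \<longleftrightarrow> factors f m))" (is "?L \<longleftrightarrow> ?R")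
proof
  assume ?L
  then obtain u where u: "is_pullback E p t m u" by (auto simp: classifies_def)
  note u' = u[unfolded is_pullback_def]
  have pm: "p \<cdot> m = tru (src E m)"
    using u' t_cmp[of u] by auto
  show ?R
  proof (intro ballI impI iffI)
    fix f assume f: "f \<in> arr E" "tgt E f = tgt E m" and h: "holds p f"
    have 1: "src E f \<in> obj E" "f \<in> Hom E (src E f) (src E p)" "bang (src E f) \<in> Hom E (src E f) one"
      "p \<cdot> f = t \<cdot> bang (src E f)" using f h p by (auto simp: holds_def tru_def)
    then have "\<exists>!h. h \<in> Hom E (src E f) (src E m) \<and> m \<cdot> h = f \<and> u \<cdot> h = bang (src E f)"
      using u' by blast
    then show "factors f m" by (auto simp: factors_def)
  next
    fix f assume "f \<in> arr E" "tgt E f = tgt E m" "factors f m"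
    then obtain h where h: "h \<in> arr E" "src E h = src E f" "tgt E h = src E m" "m \<cdot> h = f"
      by (auto simp: factors_def)
    have "holds p (m \<cdot> h)" by (rule holds_mono) (use h m p pm in \<open>auto simp: holds_def\<close>)
    then show "holds p f" using h by simp
  qed
next
  assume R: ?R
  have "factors m m" using m unfolding factors_def by (intro bexI[of _ "idt E (src E m)"]) auto
  then have pm: "p \<cdot> m = t \<cdot> bang (src E m)" using R m p by (auto simp: holds_def tru_def)
  have "is_pullback E p t m (bang (src E m))"
    unfolding is_pullback_def
  proof (intro conjI ballI impI)
    fix X x y assume X: "X \<in> obj E" and x: "x \<in> Hom E X (src E p)" and y: "y \<in> Hom E X one"
      and xy: "p \<cdot> x = t \<cdot> y"
    have "holds p x" using x y xy t_cmp[of y] by (auto simp: holds_def)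
    then have "factors x m" using R x p by auto
    then obtain h where h: "h \<in> arr E" "src E h = src E x" "tgt E h = src E m" "m \<cdot> h = x"
      by (auto simp: factors_def)
    have "bang (src E m) \<cdot> h = y"
      using bang_unique[of "bang (src E m) \<cdot> h"] bang_unique[of y] h x y m by simp
    then show "\<exists>!h. h \<in> Hom E X (src E m) \<and> m \<cdot> h = x \<and> bang (src E m) \<cdot> h = y"
      using h x m by (intro ex1I[of _ h]) (auto intro: monicD)
  qed (use m p pm in auto)
  then show ?L by (auto simp: classifies_def)
qed

lemma chr_simps [simp]:
  assumes m: "monic E m"
  shows "chr E t m \<in> arr E" "src E (chr E t m) = tgt E m" "tgt E (chr E t m) = \<Omega>"
    and classifies_chr: "classifies E t (chr E t m) m"
proof -
  have "\<exists>!\<chi>. \<chi> \<in> Hom E (tgt E m) (tgt E t) \<and> classifies E t \<chi> m"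
    using classifier m by (auto simp: subobject_classifier_def)
  from theI'[OF this, folded chr_def]
  show "chr E t m \<in> arr E" "src E (chr E t m) = tgt E m" "tgt E (chr E t m) = \<Omega>"
    "classifies E t (chr E t m) m" by auto
qed

lemma chr_unique:
  assumes m: "monic E m" and "p \<in> arr E" "src E p = tgt E m" "tgt E p = \<Omega>" "classifies E t p m"
  shows "chr E t m = p"
proof -
  have "\<exists>!\<chi>. \<chi> \<in> Hom E (tgt E m) (tgt E t) \<and> classifies E t \<chi> m"
    using classifier m by (auto simp: subobject_classifier_def)
  then show ?thesis using assms classifies_chr[OF m] chr_simps[OF m] by auto
qed

lemma holds_chr [simp]:
  assumes "monic E m" "f \<in> arr E" "tgt E f = tgt E m"
  shows "holds (chr E t m) f \<longleftrightarrow> factors f m"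
  using classifies_chr[OF assms(1)] classifies_iff[of m "chr E t m"] assms by simp

definition eqz :: "'a \<Rightarrow> 'a \<Rightarrow> 'a" where
  "eqz a b = (SOME e. is_equalizer E a b e)"

lemma eqz_simps [simp]:
  assumes ab: "a \<in> arr E" "b \<in> arr E" "src E a = src E b" "tgt E a = tgt E b"
  shows "monic E (eqz a b)" "tgt E (eqz a b) = src E b"
    and factors_eqz: "f \<in> arr E \<Longrightarrow> tgt E f = src E b \<Longrightarrow> factors f (eqz a b) \<longleftrightarrow> a \<cdot> f = b \<cdot> f"
    and eqz_eq: "a \<cdot> eqz a b = b \<cdot> eqz a b"
proof -
  have "\<exists>e. is_equalizer E a b e"
    using elementary ab by (simp add: elementary_topos_def has_finite_limits_def)
  then have "is_equalizer E a b (eqz a b)" unfolding eqz_def by (rule someI_ex)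
  note e = this[unfolded is_equalizer_def]
  let ?e = "eqz a b"
  have earr: "?e \<in> arr E" "tgt E ?e = src E b" and ee: "a \<cdot> ?e = b \<cdot> ?e"
    using e ab by auto
  have u: "\<And>x. x \<in> arr E \<Longrightarrow> tgt E x = src E b \<Longrightarrow> a \<cdot> x = b \<cdot> x \<Longrightarrow>
      \<exists>!h. h \<in> Hom E (src E x) (src E ?e) \<and> ?e \<cdot> h = x" using e ab by metis
  have comp: "a \<cdot> ?e \<cdot> h = b \<cdot> ?e \<cdot> h" if "h \<in> arr E" "tgt E h = src E ?e" for h
    using that earr ab assoc[of h ?e a] assoc[of h ?e b] ee by simp
  show "tgt E ?e = src E b" "a \<cdot> ?e = b \<cdot> ?e" by fact+
  show "monic E ?e"
  proof (rule monicI)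
    fix f g assume fg: "f \<in> arr E" "g \<in> arr E" "src E f = src E g" "tgt E f = src E ?e"
      "tgt E g = src E ?e" "?e \<cdot> f = ?e \<cdot> g"
    have "\<exists>!h. h \<in> Hom E (src E (?e \<cdot> f)) (src E ?e) \<and> ?e \<cdot> h = ?e \<cdot> f"
      by (rule u) (use fg earr comp in auto)
    then show "f = g" using fg earr by auto
  qed (use earr in auto)
  show "factors f ?e \<longleftrightarrow> a \<cdot> f = b \<cdot> f" if f: "f \<in> arr E" "tgt E f = src E b" for f
  proof
    assume "factors f ?e"
    then show "a \<cdot> f = b \<cdot> f" using comp by (auto simp: factors_def)
  next
    assume "a \<cdot> f = b \<cdot> f"
    from u[OF f this] show "factors f ?e" by (auto simp: factors_def)
  qed
qed

abbreviation pred :: "'a \<Rightarrow> bool" where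
  "pred p \<equiv> p \<in> arr E \<and> tgt E p = \<Omega>"

definition subob :: "'a \<Rightarrow> 'a" where
  "subob p = eqz p (tru (src E p))"

lemma subob_simps [simp]:
  assumes "pred p"
  shows "monic E (subob p)" "tgt E (subob p) = src E p"
    and factors_subob: "f \<in> arr E \<Longrightarrow> tgt E f = src E p \<Longrightarrow> factors f (subob p) \<longleftrightarrow> holds p f"
  using assms by (auto simp: subob_def holds_def factors_eqz)

lemma classifies_subob: "pred p \<Longrightarrow> classifies E t p (subob p)"
  by (subst classifies_iff) auto

text \<open>Extensionality: two predicates true at the same generalised elements classify the same
subobject, so the uniqueness of characteristic morphisms identifies them. Almost all equations
between predicates below are proved in this way.\<close>

lemma pred_eqI:
  assumes p: "pred p" and q: "pred q" and src: "src E p = src E q"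
    and eq: "\<And>f. f \<in> arr E \<Longrightarrow> tgt E f = src E q \<Longrightarrow> holds p f \<longleftrightarrow> holds q f"
  shows "p = q"
proof -
  have "classifies E t q (subob p)"
    by (subst classifies_iff) (use p q eq src in auto)
  then have "chr E t (subob p) = q" by (intro chr_unique) (use p q src in auto)
  moreover have "chr E t (subob p) = p" by (intro chr_unique) (use p classifies_subob in auto)
  ultimately show ?thesis by simp
qed

lemma chr_subob [simp]: "pred p \<Longrightarrow> chr E t (subob p) = p"
  by (intro chr_unique) (use classifies_subob in auto)

lemma chr_cmp_eq:
  assumes m: "monic E m" and n: "monic E n" "tgt E n = src E f" and f: "f \<in> arr E" "tgt E f = tgt E m"
    and iff: "\<And>g. g \<in> arr E \<Longrightarrow> tgt E g = src E f \<Longrightarrow> factors g n \<longleftrightarrow> factors (f \<cdot> g) m"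
  shows "chr E t n = chr E t m \<cdot> f"
  by (rule pred_eqI) (use assms in auto)

text \<open>The predicate ``\<open>a x = b x\<close>'' on the common domain. Implication and
universal quantification are instances of it.\<close>

definition eqp :: "'a \<Rightarrow> 'a \<Rightarrow> 'a" where
  "eqp a b = chr E t (eqz a b)"

lemma eqp_simps [simp]:
  assumes "a \<in> arr E" "b \<in> arr E" "src E a = src E b" "tgt E a = tgt E b"
  shows "eqp a b \<in> arr E" "src E (eqp a b) = src E b" "tgt E (eqp a b) = \<Omega>"
    "f \<in> arr E \<Longrightarrow> tgt E f = src E b \<Longrightarrow> holds (eqp a b) f \<longleftrightarrow> a \<cdot> f = b \<cdot> f"
  using assms by (simp_all add: eqp_def factors_eqz)

subsection \<open>Conjunction and implication\<close>

definition conj :: "'a \<Rightarrow> 'a \<Rightarrow> 'a" where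
  "conj p q = omega_and E t \<cdot> pairing E p q"

text \<open>In particular \<open>t\<close> paired with itself is monic, which is what \<open>omega_and\<close> classifies.\<close>

lemma from_one_monic: "f \<in> arr E \<Longrightarrow> src E f = one \<Longrightarrow> monic E f"
  by (rule monicI) (metis bang_unique)+

lemma omega_and_simps [simp]: "omega_and E t \<in> arr E" "src E (omega_and E t) = prod_obj E \<Omega> \<Omega>"
    "tgt E (omega_and E t) = \<Omega>"
  and holds_omega_and: "f \<in> arr E \<Longrightarrow> g \<in> arr E \<Longrightarrow> src E f = src E g \<Longrightarrow> tgt E f = \<Omega> \<Longrightarrow> tgt E g = \<Omega> \<Longrightarrow>
    omega_and E t \<cdot> pairing E f g = tru (src E g) \<longleftrightarrow> f = tru (src E f) \<and> g = tru (src E g)"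
proof -
  have m: "monic E (pairing E t t)" by (intro from_one_monic) auto
  show "omega_and E t \<in> arr E" "src E (omega_and E t) = prod_obj E \<Omega> \<Omega>" "tgt E (omega_and E t) = \<Omega>"
    using m by (simp_all add: omega_and_def)
  fix f g assume fg: "f \<in> arr E" "g \<in> arr E" "src E f = src E g" "tgt E f = \<Omega>" "tgt E g = \<Omega>"
  have "factors (pairing E f g) (pairing E t t) \<longleftrightarrow> f = tru (src E f) \<and> g = tru (src E g)"
  proof
    assume "factors (pairing E f g) (pairing E t t)"
    then obtain h where h: "h \<in> arr E" "src E h = src E g" "tgt E h = one" "pairing E t t \<cdot> h = pairing E f g"
      using fg by (auto simp: factors_def)
    then have "pr1 E \<Omega> \<Omega> \<cdot> pairing E f g = t \<cdot> h" "pr2 E \<Omega> \<Omega> \<cdot> pairing E f g = t \<cdot> h"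
      by (simp_all flip: h(4))
    then show "f = tru (src E f) \<and> g = tru (src E g)" using h fg by (simp add: t_cmp)
  next
    assume a: "f = tru (src E f) \<and> g = tru (src E g)"
    have "pairing E t t \<cdot> bang (src E g) = pairing E f g" using a fg by (simp add: tru_def)
    then show "factors (pairing E f g) (pairing E t t)" using fg
      unfolding factors_def by (intro bexI[of _ "bang (src E g)"]) auto
  qed
  moreover have "holds (chr E t (pairing E t t)) (pairing E f g) \<longleftrightarrow> factors (pairing E f g) (pairing E t t)"
    using m fg by simp
  ultimately show "omega_and E t \<cdot> pairing E f g = tru (src E g) \<longleftrightarrow> f = tru (src E f) \<and> g = tru (src E g)"
    using fg by (simp add: holds_def omega_and_def)
qed

lemma conj_simps [simp]:
  assumes "pred p" "pred q" "src E p = src E q"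
  shows "conj p q \<in> arr E" "src E (conj p q) = src E q" "tgt E (conj p q) = \<Omega>"
    "f \<in> arr E \<Longrightarrow> tgt E f = src E q \<Longrightarrow> holds (conj p q) f \<longleftrightarrow> holds p f \<and> holds q f"
  using assms holds_omega_and[of "p \<cdot> f" "q \<cdot> f"] by (auto simp: conj_def holds_def)

text \<open>\<open>p \<le> q\<close> iff \<open>p \<and> q = p\<close>, and the internal form of this equation is the implication.\<close>

definition imp :: "'a \<Rightarrow> 'a \<Rightarrow> 'a" where
  "imp p q = eqp (conj p q) p"

lemma imp_simps [simp]:
  assumes "pred p" "pred q" "src E p = src E q"
  shows "imp p q \<in> arr E" "src E (imp p q) = src E q" "tgt E (imp p q) = \<Omega>"
    and holds_imp: "f \<in> arr E \<Longrightarrow> tgt E f = src E q \<Longrightarrow> holds (imp p q) f \<longleftrightarrow>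
      (\<forall>g. g \<in> arr E \<longrightarrow> tgt E g = src E f \<longrightarrow> holds p (f \<cdot> g) \<longrightarrow> holds q (f \<cdot> g))"
proof -
  show "imp p q \<in> arr E" "src E (imp p q) = src E q" "tgt E (imp p q) = \<Omega>"
    using assms by (simp_all add: imp_def)
  assume f: "f \<in> arr E" "tgt E f = src E q"
  have "holds (imp p q) f \<longleftrightarrow> conj p q \<cdot> f = p \<cdot> f" using assms f by (simp add: imp_def)
  also have "\<dots> \<longleftrightarrow> (\<forall>g. g \<in> arr E \<longrightarrow> tgt E g = src E f \<longrightarrow> holds p (f \<cdot> g) \<longrightarrow> holds q (f \<cdot> g))" (is "_ \<longleftrightarrow> ?R")
  proof
    assume eq: "conj p q \<cdot> f = p \<cdot> f"
    show ?R
    proof (intro allI impI)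
      fix g assume g: "g \<in> arr E" "tgt E g = src E f" "holds p (f \<cdot> g)"
      then have "holds (conj p q \<cdot> f) g" using eq f assms by simp
      then show "holds q (f \<cdot> g)" using f g assms by simp
    qed
  next
    assume R: ?R
    show "conj p q \<cdot> f = p \<cdot> f"
      by (rule pred_eqI) (use f assms R in auto)
  qed
  finally show "holds (imp p q) f \<longleftrightarrow> ?R" .
qed

declare holds_imp [simp del]

subsection \<open>Universal quantification, falsity and disjunction\<close>

lemma exponential:
  assumes "A \<in> obj E" "B \<in> obj E"
  obtains P ev where "P \<in> obj E" "ev \<in> arr E" "src E ev = prod_obj E P A" "tgt E ev = B"
    "\<And>X f. X \<in> obj E \<Longrightarrow> f \<in> arr E \<Longrightarrow> src E f = prod_obj E X A \<Longrightarrow> tgt E f = B \<Longrightarrow>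
      \<exists>g\<in>arr E. src E g = X \<and> tgt E g = P \<and> ev \<cdot> prod_arr E g (idt E A) = f"
    "\<And>g g'. g \<in> arr E \<Longrightarrow> g' \<in> arr E \<Longrightarrow> src E g = src E g' \<Longrightarrow> tgt E g = P \<Longrightarrow> tgt E g' = P \<Longrightarrow>
      ev \<cdot> prod_arr E g (idt E A) = ev \<cdot> prod_arr E g' (idt E A) \<Longrightarrow> g = g'"
proof -
  obtain P ev where P: "P \<in> obj E" "ev \<in> Hom E (prod_obj E P A) B"
    and u: "\<And>X f. X \<in> obj E \<Longrightarrow> f \<in> Hom E (prod_obj E X A) B \<Longrightarrow>
          \<exists>!g. g \<in> Hom E X P \<and> ev \<cdot> prod_arr E g (idt E A) = f"
    using elementary assms unfolding elementary_topos_def has_exponentials_def by metis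
  show thesis
  proof (rule that[of P ev])
    fix X f assume "X \<in> obj E" "f \<in> arr E" "src E f = prod_obj E X A" "tgt E f = B"
    then show "\<exists>g\<in>arr E. src E g = X \<and> tgt E g = P \<and> ev \<cdot> prod_arr E g (idt E A) = f"
      using u[of X f] by auto
  next
    fix g g' assume g: "g \<in> arr E" "g' \<in> arr E" "src E g = src E g'" "tgt E g = P" "tgt E g' = P"
      "ev \<cdot> prod_arr E g (idt E A) = ev \<cdot> prod_arr E g' (idt E A)"
    then show "g = g'" using u[of "src E g" "ev \<cdot> prod_arr E g (idt E A)"] P assms by auto
  qed (use P in auto)
qed

lemma prod_arr_cmp_left:
  assumes "A \<in> obj E" "f \<in> arr E" "g \<in> arr E" "src E g = tgt E f"
  shows "prod_arr E (g \<cdot> f) (idt E A) = prod_arr E g (idt E A) \<cdot> prod_arr E f (idt E A)"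
  using assms by (simp add: prod_arr_def)

text \<open>The quantified predicate says that the transpose \<open>X \<rightarrow> \<Omega>\<^bsup>A\<^esup>\<close> of \<open>p\<close> equals that of \<open>true\<close>. Restricted
along \<open>f\<close>, this means that \<open>p\<close> is true at \<open>f \<times> 1 : Y \<times> A \<rightarrow> X \<times> A\<close>, which is the universal case among
the pairs of elements occurring in the statement.\<close>

lemma forall_exists:
  assumes X: "X \<in> obj E" and A: "A \<in> obj E" and p: "pred p" "src E p = prod_obj E X A"
  shows "\<exists>q. pred q \<and> src E q = X \<and> (\<forall>f. f \<in> arr E \<longrightarrow> tgt E f = X \<longrightarrow> (holds q f \<longleftrightarrow>
    (\<forall>g y. g \<in> arr E \<longrightarrow> tgt E g = src E f \<longrightarrow> y \<in> arr E \<longrightarrow> src E y = src E g \<longrightarrow> tgt E y = A \<longrightarrow>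
       holds p (pairing E (f \<cdot> g) y))))"
proof -
  have O: "\<Omega> \<in> obj E" by simp
  obtain P ev where ev: "P \<in> obj E" "ev \<in> arr E" "src E ev = prod_obj E P A" "tgt E ev = \<Omega>"
    and ex: "\<And>X f. X \<in> obj E \<Longrightarrow> f \<in> arr E \<Longrightarrow> src E f = prod_obj E X A \<Longrightarrow> tgt E f = \<Omega> \<Longrightarrow>
      \<exists>g\<in>arr E. src E g = X \<and> tgt E g = P \<and> ev \<cdot> prod_arr E g (idt E A) = f"
    and un: "\<And>g g'. g \<in> arr E \<Longrightarrow> g' \<in> arr E \<Longrightarrow> src E g = src E g' \<Longrightarrow> tgt E g = P \<Longrightarrow> tgt E g' = P \<Longrightarrow>
      ev \<cdot> prod_arr E g (idt E A) = ev \<cdot> prod_arr E g' (idt E A) \<Longrightarrow> g = g'"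
    by (rule exponential[OF A O]) (rule that)
  obtain c where c: "c \<in> arr E" "src E c = X" "tgt E c = P" "ev \<cdot> prod_arr E c (idt E A) = p"
    using ex[OF X, of p] p by auto
  obtain d where d: "d \<in> arr E" "src E d = X" "tgt E d = P"
      "ev \<cdot> prod_arr E d (idt E A) = tru (prod_obj E X A)"
    using ex[OF X, of "tru (prod_obj E X A)"] X A by auto
  show ?thesis
  proof (intro exI[of _ "eqp c d"] conjI allI impI)
    fix f assume f: "f \<in> arr E" "tgt E f = X"
    let ?fA = "prod_arr E f (idt E A)"
    have ev_cmp: "ev \<cdot> prod_arr E (g \<cdot> f) (idt E A) = (ev \<cdot> prod_arr E g (idt E A)) \<cdot> ?fA"
      if "g \<in> arr E" "src E g = X" "tgt E g = P" for g
      using that f A ev prod_arr_cmp_left[of A f g] by (simp del: prod_arr_cmp)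
    have "holds (eqp c d) f \<longleftrightarrow> c \<cdot> f = d \<cdot> f" using c d f by simp
    also have "\<dots> \<longleftrightarrow> p \<cdot> ?fA = tru (prod_obj E X A) \<cdot> ?fA"
      using un[of "c \<cdot> f" "d \<cdot> f"] c d f ev_cmp[of c] ev_cmp[of d] by auto
    also have "\<dots> \<longleftrightarrow> holds p ?fA" using p f A by (simp add: holds_def)
    also have "\<dots> \<longleftrightarrow> (\<forall>g y. g \<in> arr E \<longrightarrow> tgt E g = src E f \<longrightarrow> y \<in> arr E \<longrightarrow> src E y = src E g \<longrightarrow> tgt E y = A \<longrightarrow>
       holds p (pairing E (f \<cdot> g) y))" (is "_ \<longleftrightarrow> ?R")
    proof
      assume h: "holds p ?fA"
      show ?R
      proof (intro allI impI)
        fix g y assume g: "g \<in> arr E" "tgt E g = src E f" "y \<in> arr E" "src E y = src E g" "tgt E y = A"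
        have "holds p (?fA \<cdot> pairing E g y)" by (rule holds_mono) (use h g f p A in auto)
        then show "holds p (pairing E (f \<cdot> g) y)" using g f p A by simp
      qed
    next
      assume R: ?R
      have "holds p (pairing E (f \<cdot> pr1 E (src E f) A) (pr2 E (src E f) A))"
        using R f A by simp
      then show "holds p ?fA" using A f by (simp add: prod_arr_def)
    qed
    finally show "holds (eqp c d) f \<longleftrightarrow> ?R" .
  qed (use c d in auto)
qed

definition forall :: "'o \<Rightarrow> 'o \<Rightarrow> 'a \<Rightarrow> 'a" where
  "forall X A p = (SOME q. pred q \<and> src E q = X \<and> (\<forall>f. f \<in> arr E \<longrightarrow> tgt E f = X \<longrightarrow> (holds q f \<longleftrightarrow>
    (\<forall>g y. g \<in> arr E \<longrightarrow> tgt E g = src E f \<longrightarrow> y \<in> arr E \<longrightarrow> src E y = src E g \<longrightarrow> tgt E y = A \<longrightarrow>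
       holds p (pairing E (f \<cdot> g) y)))))"

lemma forall_simps [simp]:
  assumes "X \<in> obj E" "A \<in> obj E" "pred p" "src E p = prod_obj E X A"
  shows "forall X A p \<in> arr E" "src E (forall X A p) = X" "tgt E (forall X A p) = \<Omega>"
    and holds_forall: "f \<in> arr E \<Longrightarrow> tgt E f = X \<Longrightarrow> holds (forall X A p) f \<longleftrightarrow>
    (\<forall>g y. g \<in> arr E \<longrightarrow> tgt E g = src E f \<longrightarrow> y \<in> arr E \<longrightarrow> src E y = src E g \<longrightarrow> tgt E y = A \<longrightarrow>
       holds p (pairing E (f \<cdot> g) y))"
  using someI_ex[OF forall_exists[OF assms], folded forall_def] by blast+

declare holds_forall [simp del]

text \<open>Falsity is \<open>\<forall>w : \<Omega>. w\<close>.\<close>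

definition bot :: "'o \<Rightarrow> 'a" where
  "bot X = forall X \<Omega> (pr2 E X \<Omega>)"

lemma bot_simps [simp]:
  assumes "X \<in> obj E"
  shows "bot X \<in> arr E" "src E (bot X) = X" "tgt E (bot X) = \<Omega>"
    and holds_bot: "f \<in> arr E \<Longrightarrow> tgt E f = X \<Longrightarrow> holds (bot X) f \<longleftrightarrow>
    (\<forall>g y. g \<in> arr E \<longrightarrow> tgt E g = src E f \<longrightarrow> y \<in> arr E \<longrightarrow> src E y = src E g \<longrightarrow> tgt E y = \<Omega> \<longrightarrow>
       y = tru (src E g))"
proof -
  have pr2: "holds (pr2 E X \<Omega>) (pairing E a b) \<longleftrightarrow> b = tru (src E b)"
    if "a \<in> arr E" "b \<in> arr E" "src E a = src E b" "tgt E a = X" "tgt E b = \<Omega>" for a b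
    using that by (simp add: holds_def)
  show "bot X \<in> arr E" "src E (bot X) = X" "tgt E (bot X) = \<Omega>"
    using assms by (simp_all add: bot_def)
  assume "f \<in> arr E" "tgt E f = X"
  then show "holds (bot X) f \<longleftrightarrow>
    (\<forall>g y. g \<in> arr E \<longrightarrow> tgt E g = src E f \<longrightarrow> y \<in> arr E \<longrightarrow> src E y = src E g \<longrightarrow> tgt E y = \<Omega> \<longrightarrow>
       y = tru (src E g))"
    using assms by (simp add: bot_def holds_forall pr2)
qed

declare holds_bot [simp del]

text \<open>The second-order encoding \<open>\<forall>w : \<Omega>. ((p \<Rightarrow> w) \<and> (q \<Rightarrow> w)) \<Rightarrow> w\<close>, available without any colimits.\<close>

definition disj :: "'a \<Rightarrow> 'a \<Rightarrow> 'a" where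
  "disj p q = (let X = src E q; p' = p \<cdot> pr1 E X \<Omega>; q' = q \<cdot> pr1 E X \<Omega>; w = pr2 E X \<Omega>
     in forall X \<Omega> (imp (conj (imp p' w) (imp q' w)) w))"

lemma disj_simps [simp]:
  assumes "pred p" "pred q" "src E p = src E q"
  shows "disj p q \<in> arr E" "src E (disj p q) = src E q" "tgt E (disj p q) = \<Omega>"
    and holds_disj: "f \<in> arr E \<Longrightarrow> tgt E f = src E q \<Longrightarrow> holds (disj p q) f \<longleftrightarrow>
    (\<forall>g y. g \<in> arr E \<longrightarrow> tgt E g = src E f \<longrightarrow> y \<in> arr E \<longrightarrow> src E y = src E g \<longrightarrow> tgt E y = \<Omega> \<longrightarrow>
      (\<forall>k. k \<in> arr E \<longrightarrow> tgt E k = src E g \<longrightarrow>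
         (\<forall>h. h \<in> arr E \<longrightarrow> tgt E h = src E k \<longrightarrow> holds p (f \<cdot> g \<cdot> k \<cdot> h) \<longrightarrow> holds y (k \<cdot> h)) \<longrightarrow>
         (\<forall>h. h \<in> arr E \<longrightarrow> tgt E h = src E k \<longrightarrow> holds q (f \<cdot> g \<cdot> k \<cdot> h) \<longrightarrow> holds y (k \<cdot> h)) \<longrightarrow>
         holds y k))"
proof -
  show "disj p q \<in> arr E" "src E (disj p q) = src E q" "tgt E (disj p q) = \<Omega>"
    using assms by (simp_all add: disj_def Let_def)
  have pr2: "holds (pr2 E (src E q) \<Omega>) (pairing E a (y \<cdot> k)) \<longleftrightarrow> holds y k"
    if "a \<in> arr E" "k \<in> arr E" "y \<in> arr E" "src E y = tgt E k" "src E a = src E k"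
      "tgt E a = src E q" "tgt E y = \<Omega>" for a y k
    using that by (simp add: holds_def)
  assume f: "f \<in> arr E" "tgt E f = src E q"
  show "holds (disj p q) f \<longleftrightarrow>
    (\<forall>g y. g \<in> arr E \<longrightarrow> tgt E g = src E f \<longrightarrow> y \<in> arr E \<longrightarrow> src E y = src E g \<longrightarrow> tgt E y = \<Omega> \<longrightarrow>
      (\<forall>k. k \<in> arr E \<longrightarrow> tgt E k = src E g \<longrightarrow>
         (\<forall>h. h \<in> arr E \<longrightarrow> tgt E h = src E k \<longrightarrow> holds p (f \<cdot> g \<cdot> k \<cdot> h) \<longrightarrow> holds y (k \<cdot> h)) \<longrightarrow>
         (\<forall>h. h \<in> arr E \<longrightarrow> tgt E h = src E k \<longrightarrow> holds q (f \<cdot> g \<cdot> k \<cdot> h) \<longrightarrow> holds y (k \<cdot> h)) \<longrightarrow>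
         holds y k))"
    using assms f by (simp add: disj_def Let_def holds_forall holds_imp pr2 imp_conjL)
qed

declare holds_disj [simp del]

definition neg :: "'a \<Rightarrow> 'a" where
  "neg p = imp p (bot (src E p))"

lemma neg_simps [simp]:
  assumes "pred p"
  shows "neg p \<in> arr E" "src E (neg p) = src E p" "tgt E (neg p) = \<Omega>"
  using assms by (simp_all add: neg_def)

subsection \<open>The order on predicates\<close>

definition leq :: "'a \<Rightarrow> 'a \<Rightarrow> bool" (infix \<open>\<preceq>\<close> 50) where
  "p \<preceq> q \<longleftrightarrow> (\<forall>f. f \<in> arr E \<longrightarrow> tgt E f = src E p \<longrightarrow> holds p f \<longrightarrow> holds q f)"

lemma leq_refl [simp]: "p \<preceq> p"
  by (simp add: leq_def)

lemma leq_trans: "p \<preceq> q \<Longrightarrow> q \<preceq> r \<Longrightarrow> src E p = src E q \<Longrightarrow> p \<preceq> r"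
  by (simp add: leq_def)

lemma leq_antisym: "pred p \<Longrightarrow> pred q \<Longrightarrow> src E p = src E q \<Longrightarrow> p \<preceq> q \<Longrightarrow> q \<preceq> p \<Longrightarrow> p = q"
  by (rule pred_eqI) (auto simp: leq_def)

lemma leq_tru [simp]: "X = src E p \<Longrightarrow> p \<preceq> tru X"
  by (simp add: leq_def)

lemma tru_leq: "pred p \<Longrightarrow> X = src E p \<Longrightarrow> tru X \<preceq> p \<Longrightarrow> p = tru X"
  by (rule leq_antisym) auto

lemma leq_conj_iff: "pred p \<Longrightarrow> pred q \<Longrightarrow> src E p = src E q \<Longrightarrow> r \<in> arr E \<Longrightarrow> src E r = src E q \<Longrightarrow>
    r \<preceq> conj p q \<longleftrightarrow> r \<preceq> p \<and> r \<preceq> q"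
  by (auto simp: leq_def)

lemma conj_leq [simp]:
  assumes "pred p" "pred q" "src E p = src E q"
  shows "conj p q \<preceq> p" "conj p q \<preceq> q"
  using assms by (auto simp: leq_def)

lemma leq_iff_conj: "pred p \<Longrightarrow> pred q \<Longrightarrow> src E p = src E q \<Longrightarrow> p \<preceq> q \<longleftrightarrow> conj p q = p"
proof
  assume *: "pred p" "pred q" "src E p = src E q"
  then show "p \<preceq> q \<Longrightarrow> conj p q = p" by (intro leq_antisym) (auto simp: leq_conj_iff)
  show "conj p q = p \<Longrightarrow> p \<preceq> q" using * conj_leq(2)[of p q] by auto
qed

lemma leq_imp_iff:
  assumes "pred p" "pred q" "pred r" "src E p = src E q" "src E r = src E q"
  shows "r \<preceq> imp p q \<longleftrightarrow> conj r p \<preceq> q"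
proof
  assume *: "r \<preceq> imp p q"
  show "conj r p \<preceq> q"
    unfolding leq_def
  proof (intro allI impI)
    fix f assume f: "f \<in> arr E" "tgt E f = src E (conj r p)" "holds (conj r p) f"
    then have "holds (imp p q) f" "holds p f" using * assms by (auto simp: leq_def)
    then have "\<And>g. g \<in> arr E \<Longrightarrow> tgt E g = src E f \<Longrightarrow> holds p (f \<cdot> g) \<Longrightarrow> holds q (f \<cdot> g)"
      using f assms by (simp add: holds_imp)
    from this[of "idt E (src E f)"] show "holds q f" using \<open>holds p f\<close> f by simp
  qed
next
  assume *: "conj r p \<preceq> q"
  show "r \<preceq> imp p q"
    unfolding leq_def
  proof (intro allI impI)
    fix f assume f: "f \<in> arr E" "tgt E f = src E r" "holds r f"
    have "holds q (f \<cdot> g)" if "g \<in> arr E" "tgt E g = src E f" "holds p (f \<cdot> g)" for g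
      using * f that assms holds_mono[of r f g] by (auto simp: leq_def)
    then show "holds (imp p q) f" using f assms by (simp add: holds_imp)
  qed
qed

lemma bot_leq [simp]: "pred q \<Longrightarrow> src E q = X \<Longrightarrow> bot X \<preceq> q"
  unfolding leq_def
proof (intro allI impI)
  fix f assume q: "pred q" "src E q = X" and f: "f \<in> arr E" "tgt E f = src E (bot X)" "holds (bot X) f"
  then have "X \<in> obj E" by auto
  then have "\<And>g y. g \<in> arr E \<Longrightarrow> tgt E g = src E f \<Longrightarrow> y \<in> arr E \<Longrightarrow> src E y = src E g \<Longrightarrow> tgt E y = \<Omega> \<Longrightarrow>
       y = tru (src E g)" using f by (simp add: holds_bot)
  from this[of "idt E (src E f)" "q \<cdot> f"] show "holds q f"
    using q f \<open>X \<in> obj E\<close> by (simp add: holds_def)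
qed

lemma leq_disj [simp]:
  assumes "pred p" "pred q" "src E p = src E q"
  shows "p \<preceq> disj p q" "q \<preceq> disj p q"
proof -
  have "holds (disj p q) f" if f: "f \<in> arr E" "tgt E f = src E q" "r = p \<or> r = q" "holds r f" for f r
  proof -
    have r: "holds r (f \<cdot> g \<cdot> k)" if "g \<in> arr E" "tgt E g = src E f" "k \<in> arr E" "tgt E k = src E g" for g k
      by (rule holds_mono) (use f assms that in auto)
    show ?thesis unfolding holds_disj[OF assms f(1,2)]
    proof (intro allI impI)
      fix g y k
      assume g: "g \<in> arr E" "tgt E g = src E f" and y: "y \<in> arr E" "src E y = src E g" "tgt E y = \<Omega>"
       and k: "k \<in> arr E" "tgt E k = src E g"
       and h: "\<forall>h. h \<in> arr E \<longrightarrow> tgt E h = src E k \<longrightarrow> holds p (f \<cdot> g \<cdot> k \<cdot> h) \<longrightarrow> holds y (k \<cdot> h)"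
        "\<forall>h. h \<in> arr E \<longrightarrow> tgt E h = src E k \<longrightarrow> holds q (f \<cdot> g \<cdot> k \<cdot> h) \<longrightarrow> holds y (k \<cdot> h)"
      have "holds y (k \<cdot> idt E (src E k))"
        using h[rule_format, of "idt E (src E k)"] r[OF g k] f(3) k by auto
      then show "holds y k" using k by simp
    qed
  qed
  then show "p \<preceq> disj p q" "q \<preceq> disj p q" using assms by (auto simp: leq_def)
qed

lemma disj_leq:
  assumes "pred p" "pred q" "pred r" "src E p = src E q" "src E r = src E q"
    and le: "p \<preceq> r" "q \<preceq> r"
  shows "disj p q \<preceq> r"
  unfolding leq_def
proof (intro allI impI)
  fix f assume f: "f \<in> arr E" "tgt E f = src E (disj p q)" "holds (disj p q) f"
  then have f': "tgt E f = src E q" using assms by simp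
  have "holds (r \<cdot> f) (idt E (src E f))"
    using f(3)[unfolded holds_disj[OF assms(1,2,4) f(1) f'], rule_format,
        of "idt E (src E f)" "r \<cdot> f" "idt E (src E f)"] f f' assms
    by (auto simp: leq_def)
  then show "holds r f" using f f' assms by simp
qed

lemma conj_commute: "pred p \<Longrightarrow> pred q \<Longrightarrow> src E p = src E q \<Longrightarrow> conj p q = conj q p"
  by (rule pred_eqI) auto

lemma leq_bot_iff: "pred p \<Longrightarrow> src E p = X \<Longrightarrow> p \<preceq> bot X \<longleftrightarrow> p = bot X"
  using leq_antisym[of p "bot X"] by (auto simp: src_obj)

lemma conj_neg: "pred p \<Longrightarrow> conj (neg p) p \<preceq> bot (src E p)"
  using leq_imp_iff[of p "bot (src E p)" "neg p"] by (simp add: neg_def)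

text \<open>Excluded middle is never refuted: a refutation of \<open>p \<or> \<not>p\<close> refutes \<open>p\<close> and \<open>\<not>p\<close> alike. Hence
\<open>p \<or> \<not>p\<close> is dense for the double negation topology.\<close>

lemma neg_neg_disj_neg:
  assumes p: "pred p"
  shows "neg (neg (disj p (neg p))) = tru (src E p)"
proof (rule tru_leq)
  let ?r = "disj p (neg p)" and ?b = "bot (src E p)"
  have r: "pred ?r" "src E ?r = src E p" using p by simp_all
  have b: "pred ?b" "src E ?b = src E p" using p by simp_all
  have anti: "conj (neg ?r) q \<preceq> ?b" if "pred q" "src E q = src E p" "q \<preceq> ?r" for q
  proof -
    have "conj (neg ?r) q \<preceq> conj (neg ?r) ?r"
      using that p r leq_trans[of "conj (neg ?r) q" q ?r] by (simp add: leq_conj_iff)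
    then show ?thesis using leq_trans[OF _ conj_neg[of ?r], of "conj (neg ?r) q"] that p r by simp
  qed
  have "neg ?r \<preceq> neg p" using anti[of p] p r b by (simp add: neg_def[of p] leq_imp_iff)
  then have "neg ?r \<preceq> conj (neg ?r) (neg p)" using p r by (simp add: leq_conj_iff)
  moreover have "conj (neg ?r) (neg p) \<preceq> ?b" using anti[of "neg p"] p by simp
  ultimately have "neg ?r \<preceq> ?b" using p r leq_trans[of "neg ?r" "conj (neg ?r) (neg p)" ?b] by simp
  then have "conj (tru (src E p)) (neg ?r) \<preceq> ?b"
    using p r b leq_trans[of "conj (tru (src E p)) (neg ?r)" "neg ?r" ?b] by simp
  then show "tru (src E p) \<preceq> neg (neg ?r)"
    using p r b by (simp add: neg_def[of "neg ?r"] leq_imp_iff)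
qed (use p in simp_all)

subsection \<open>Substitution\<close>

text \<open>The truth conditions quantify over all further restrictions of a generalised element, hence every
connective commutes with precomposition.\<close>

lemma imp_cmp [simp]:
  assumes "pred p" "pred q" "src E p = src E q" "f \<in> arr E" "tgt E f = src E q"
  shows "imp p q \<cdot> f = imp (p \<cdot> f) (q \<cdot> f)"
  by (rule pred_eqI) (use assms in \<open>auto simp: holds_imp\<close>)

lemma bot_cmp [simp]:
  assumes "f \<in> arr E" "tgt E f = X"
  shows "bot X \<cdot> f = bot (src E f)"
  by (rule pred_eqI) (use assms in \<open>auto simp: holds_bot\<close>)

lemma disj_cmp [simp]:
  assumes "pred p" "pred q" "src E p = src E q" "f \<in> arr E" "tgt E f = src E q"
  shows "disj p q \<cdot> f = disj (p \<cdot> f) (q \<cdot> f)"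
  by (rule pred_eqI) (use assms in \<open>simp_all add: holds_disj\<close>)

lemma neg_cmp [simp]:
  assumes "pred p" "f \<in> arr E" "tgt E f = src E p"
  shows "neg p \<cdot> f = neg (p \<cdot> f)"
  using assms by (simp add: neg_def)

lemma leq_cmp:
  assumes "pred p" "pred q" "src E p = src E q" "f \<in> arr E" "tgt E f = src E q" "p \<preceq> q"
  shows "p \<cdot> f \<preceq> q \<cdot> f"
  using assms by (simp add: leq_def)

subsection \<open>Subobjects as predicates\<close>

lemma Sub_simps [simp]:
  "carrier (Sub C X) = {m. monic C m \<and> tgt C m = X}"
  "eq (Sub C X) m n \<longleftrightarrow> le (Sub C X) m n \<and> le (Sub C X) n m"
  by (simp_all add: Sub_def Let_def)

lemma le_Sub_iff: "le (Sub E X) m n \<longleftrightarrow> factors m n"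
  by (auto simp: Sub_def Let_def factors_def)

lemma factors_iff_leq:
  assumes "monic E m" "monic E n" "tgt E m = tgt E n"
  shows "factors m n \<longleftrightarrow> chr E t m \<preceq> chr E t n"
proof
  show "factors m n \<Longrightarrow> chr E t m \<preceq> chr E t n"
    unfolding leq_def using assms factors_trans[of _ m n] by simp
  assume "chr E t m \<preceq> chr E t n"
  then have "holds (chr E t n) m" unfolding leq_def using assms factors_refl[of m] by simp
  then show "factors m n" using assms by simp
qed

lemma Sub_presentation: "order_presentation (Sub E X) (chr E t) {p. pred p \<and> src E p = X} leq"
proof
  show "chr E t ` carrier (Sub E X) = {p. pred p \<and> src E p = X}"
  proof (intro equalityI subsetI)
    fix p assume "p \<in> {p. pred p \<and> src E p = X}"
    then show "p \<in> chr E t ` carrier (Sub E X)" by (intro image_eqI[of _ _ "subob p"]) auto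
  qed auto
qed (auto simp: le_Sub_iff factors_iff_leq intro: leq_antisym)

lemma Sub_bot:
  assumes "X \<in> obj E"
  shows "\<bottom>\<^bsub>Sub E X\<^esub> \<in> carrier (Sub E X)" "chr E t \<bottom>\<^bsub>Sub E X\<^esub> = bot X"
  using order_presentation.bottom[OF Sub_presentation, of "bot X"] assms by auto

lemma Sub_top:
  assumes "X \<in> obj E"
  shows "\<top>\<^bsub>Sub E X\<^esub> \<in> carrier (Sub E X)" "chr E t \<top>\<^bsub>Sub E X\<^esub> = tru X"
  using order_presentation.top[OF Sub_presentation, of "tru X"] assms by auto

lemma Sub_join:
  assumes "m \<in> carrier (Sub E X)" "n \<in> carrier (Sub E X)"
  shows "m \<squnion>\<^bsub>Sub E X\<^esub> n \<in> carrier (Sub E X)"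
    "chr E t (m \<squnion>\<^bsub>Sub E X\<^esub> n) = disj (chr E t m) (chr E t n)"
  using order_presentation.join[OF Sub_presentation assms, of "disj (chr E t m) (chr E t n)"] assms disj_leq
  by auto

lemma Sub_pcomp:
  assumes "m \<in> carrier (Sub E X)"
  shows "\<sim>\<^bsub>Sub E X\<^esub> m \<in> carrier (Sub E X)" "chr E t (\<sim>\<^bsub>Sub E X\<^esub> m) = neg (chr E t m)"
proof -
  let ?p = "chr E t m"
  have p: "pred ?p" "src E ?p = X" "X \<in> obj E" using assms by auto
  have eq: "conj q ?p = bot X \<longleftrightarrow> q \<preceq> neg ?p" if "pred q" "src E q = X" for q
    using that p by (simp add: neg_def leq_imp_iff leq_bot_iff)
  show "\<sim>\<^bsub>Sub E X\<^esub> m \<in> carrier (Sub E X)" "chr E t (\<sim>\<^bsub>Sub E X\<^esub> m) = neg ?p"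
    using order_presentation.pcomp[OF Sub_presentation assms, of "bot X" "\<lambda>q. conj q ?p" "neg ?p"] p eq
    by (auto simp: leq_conj_iff)
qed

lemma omega_false_eq: "omega_false E t = bot one"
  using Sub_bot[of one] by (simp add: omega_false_def)

lemma omega_not_simps [simp]: "omega_not E t \<in> arr E" "src E (omega_not E t) = \<Omega>" "tgt E (omega_not E t) = \<Omega>"
  using from_one_monic[of "bot one"] by (simp_all add: omega_not_def omega_false_eq)

text \<open>\<open>omega_not\<close> classifies \<open>false : 1 \<rightarrow> \<Omega>\<close>, so it is true at \<open>p \<cdot> f\<close> iff \<open>p \<cdot> f\<close> is constantly
false, and this is the truth condition of \<open>\<not>p\<close>.\<close>

lemma omega_not_cmp:
  assumes "pred p"
  shows "omega_not E t \<cdot> p = neg p"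
proof (rule pred_eqI)
  fix f assume f: "f \<in> arr E" "tgt E f = src E (neg p)"
  then have f': "tgt E f = src E p" using assms by simp
  have m: "monic E (bot one)" by (intro from_one_monic) auto
  have "holds (omega_not E t \<cdot> p) f \<longleftrightarrow> factors (p \<cdot> f) (bot one)"
    using assms f m by (simp add: omega_not_def omega_false_eq)
  also have "\<dots> \<longleftrightarrow> p \<cdot> f = bot (src E f)"
  proof
    assume "factors (p \<cdot> f) (bot one)"
    then obtain h where "h \<in> arr E" "src E h = src E f" "tgt E h = one" "bot one \<cdot> h = p \<cdot> f"
      using assms f by (auto simp: factors_def)
    then show "p \<cdot> f = bot (src E f)" by simp
  next
    assume "p \<cdot> f = bot (src E f)"
    then show "factors (p \<cdot> f) (bot one)"
      using assms f unfolding factors_def by (intro bexI[of _ "bang (src E f)"]) auto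
  qed
  also have "\<dots> \<longleftrightarrow> p \<cdot> f \<preceq> bot (src E p) \<cdot> f"
    using assms f leq_bot_iff[of "p \<cdot> f" "src E f"] by simp
  also have "\<dots> \<longleftrightarrow> holds (neg p) f"
  proof -
    have b: "bot (src E p) \<in> arr E" "src E (bot (src E p)) = src E p" "tgt E (bot (src E p)) = \<Omega>"
      using assms by simp_all
    show ?thesis using assms f(1) f' b by (simp add: neg_def holds_imp leq_def del: bot_cmp)
  qed
  finally show "holds (omega_not E t \<cdot> p) f \<longleftrightarrow> holds (neg p) f" .
qed (use assms in auto)

lemma boolean_topology_simps: "boolean_topology E t \<in> arr E" "src E (boolean_topology E t) = \<Omega>"
    "tgt E (boolean_topology E t) = \<Omega>"
  by (simp_all add: boolean_topology_def)

lemma boolean_topology_cmp: "pred p \<Longrightarrow> boolean_topology E t \<cdot> p = neg (neg p)"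
  by (simp add: boolean_topology_def omega_not_cmp)

text \<open>The internal order of endomorphisms of \<open>\<Omega>\<close> is the order at the generic predicate, the identity
of \<open>\<Omega>\<close>, from which all others arise by precomposition.\<close>

lemma lop_le_iff:
  assumes "k \<in> arr E" "src E k = \<Omega>" "tgt E k = \<Omega>" "j \<in> arr E" "src E j = \<Omega>" "tgt E j = \<Omega>"
  shows "lop_le E t k j \<longleftrightarrow> (\<forall>p. pred p \<longrightarrow> k \<cdot> p \<preceq> j \<cdot> p)"
proof -
  have "lop_le E t k j \<longleftrightarrow> k \<preceq> j"
    using assms leq_iff_conj[of k j] by (simp add: lop_le_def conj_def)
  also have "\<dots> \<longleftrightarrow> (\<forall>p. pred p \<longrightarrow> k \<cdot> p \<preceq> j \<cdot> p)"
  proof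
    assume *: "k \<preceq> j"
    show "\<forall>p. pred p \<longrightarrow> k \<cdot> p \<preceq> j \<cdot> p"
      using leq_cmp[of k j] * assms by simp
  next
    assume *: "\<forall>p. pred p \<longrightarrow> k \<cdot> p \<preceq> j \<cdot> p"
    have "\<Omega> \<in> obj E" by simp
    then show "k \<preceq> j" using *[rule_format, of "idt E \<Omega>"] assms by simp
  qed
  finally show ?thesis .
qed

end

section \<open>Local operators\<close>

locale local_op = topos E t
  for E :: "('o, 'a) cat" (structure) and t :: 'a +
  fixes j :: 'a
  assumes local_operator: "local_operator E t j"
begin

lemma j_simps [simp]: "j \<in> arr E" "src E j = \<Omega>" "tgt E j = \<Omega>"
  using local_operator by (auto simp: local_operator_def)

lemma j_idem [simp]: "pred p \<Longrightarrow> j \<cdot> j \<cdot> p = j \<cdot> p"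
  using cmp_extend[of j j j p] local_operator by (simp add: local_operator_def)

lemma j_tru [simp]: "X \<in> obj E \<Longrightarrow> j \<cdot> tru X = tru X"
  using cmp_extend[of j t t "bang X"] local_operator by (simp add: local_operator_def tru_def)

lemma j_conj:
  assumes "pred p" "pred q" "src E p = src E q"
  shows "j \<cdot> conj p q = conj (j \<cdot> p) (j \<cdot> q)"
proof -
  have "j \<cdot> conj p q = (j \<cdot> omega_and E t) \<cdot> pairing E p q"
    using assms by (simp add: conj_def)
  also have "\<dots> = conj (j \<cdot> p) (j \<cdot> q)"
    using assms local_operator by (simp add: local_operator_def conj_def)
  finally show ?thesis .
qed

lemma j_inc [simp]:
  assumes "pred p"
  shows "p \<preceq> j \<cdot> p"
  unfolding leq_def using assms by (auto simp: holds_def)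

lemma j_mono:
  assumes "pred p" "pred q" "src E p = src E q" "p \<preceq> q"
  shows "j \<cdot> p \<preceq> j \<cdot> q"
  using assms by (simp add: leq_iff_conj flip: j_conj)

lemma j_leq_closed:
  assumes "pred p" "pred q" "src E p = src E q" "p \<preceq> q" "j \<cdot> q = q"
  shows "j \<cdot> p \<preceq> q"
  using j_mono[OF assms(1-4)] assms(5) by simp

text \<open>Closed predicates form an exponential ideal: \<open>j(p \<Rightarrow> q) \<and> p \<le> j((p \<Rightarrow> q) \<and> p) \<le> jq = q\<close>.\<close>

lemma closed_imp:
  assumes "pred p" "pred q" "src E p = src E q" "j \<cdot> q = q"
  shows "j \<cdot> imp p q = imp p q"
proof (rule leq_antisym)
  have "conj (imp p q) p \<preceq> q" using assms by (simp flip: leq_imp_iff)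
  then have "j \<cdot> conj (imp p q) p \<preceq> q" using assms by (intro j_leq_closed) auto
  moreover have "conj (j \<cdot> imp p q) p \<preceq> j \<cdot> conj (imp p q) p"
    using assms by (simp add: j_conj leq_conj_iff leq_trans[of _ p])
  ultimately have "conj (j \<cdot> imp p q) p \<preceq> q" using assms leq_trans[of "conj (j \<cdot> imp p q) p" "j \<cdot> conj (imp p q) p" q] by simp
  then show "j \<cdot> imp p q \<preceq> imp p q" using assms by (simp add: leq_imp_iff)
qed (use assms in auto)

subsection \<open>Dense monomorphisms and closed predicates\<close>

lemma jclosure_simps:
  assumes "monic E m"
  shows "monic E (jclosure E t j m)" "tgt E (jclosure E t j m) = tgt E m"
    "chr E t (jclosure E t j m) = j \<cdot> chr E t m"
proof -
  let ?s = "subob (j \<cdot> chr E t m)"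
  have "\<exists>c. c \<in> carrier (Sub E (tgt E m)) \<and> classifies E t (j \<cdot> chr E t m) c"
    using assms by (intro exI[of _ ?s]) (auto intro: classifies_subob)
  from someI_ex[OF this, folded jclosure_def]
  show *: "monic E (jclosure E t j m)" "tgt E (jclosure E t j m) = tgt E m" by auto
  show "chr E t (jclosure E t j m) = j \<cdot> chr E t m"
    by (rule chr_unique) (use * someI_ex[OF \<open>\<exists>c. _ c\<close>, folded jclosure_def] assms in auto)
qed

lemma jdense_iff: "jdense E t j m \<longleftrightarrow> monic E m \<and> j \<cdot> chr E t m = tru (tgt E m)"
proof (cases "monic E m")
  case True
  interpret order_presentation "Sub E (tgt E m)" "chr E t" "{p. pred p \<and> src E p = tgt E m}" leq
    by (rule Sub_presentation)
  show ?thesis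
    using True jclosure_simps[OF True] Sub_top[of "tgt E m"]
      eq_iff[of "jclosure E t j m" "\<top>\<^bsub>Sub E (tgt E m)\<^esub>"] by (auto simp: jdense_def simp del: Sub_simps(2))
next
  case False
  then show ?thesis by (simp add: jdense_def)
qed

text \<open>With \<open>d\<close> the dense predicate of \<open>m\<close>, agreement on \<open>m\<close> gives \<open>p \<and> d \<le> q\<close>, and applying \<open>j\<close> turns this
into \<open>p \<le> q\<close> because \<open>jd\<close> is true.\<close>

lemma closed_eq_if_dense:
  assumes m: "jdense E t j m" and p: "pred p" "src E p = tgt E m" "j \<cdot> p = p"
    and q: "pred q" "src E q = tgt E m" "j \<cdot> q = q" and eq: "p \<cdot> m = q \<cdot> m"
  shows "p = q"
proof -
  have m': "monic E m" "j \<cdot> chr E t m = tru (tgt E m)" using m by (auto simp: jdense_iff)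
  have *: "p \<preceq> q" if p: "pred p" "src E p = tgt E m" "j \<cdot> p = p"
    and q: "pred q" "src E q = tgt E m" "j \<cdot> q = q" and eq: "p \<cdot> m = q \<cdot> m" for p q
  proof -
    have "conj p (chr E t m) \<preceq> q" unfolding leq_def
    proof (intro allI impI)
      fix f assume f: "f \<in> arr E" "tgt E f = src E (conj p (chr E t m))" "holds (conj p (chr E t m)) f"
      then have f': "holds p f" "factors f m" "tgt E f = tgt E m" using p m' by auto
      then obtain h where h: "h \<in> arr E" "src E h = src E f" "tgt E h = src E m" "m \<cdot> h = f"
        by (auto simp: factors_def)
      have "holds (p \<cdot> m) h" using h p m' f' by simp
      then have "holds q (m \<cdot> h)" using eq h q m' by simp
      then show "holds q f" using h by simp
    qed
    then have "j \<cdot> conj p (chr E t m) \<preceq> q" using p q m' by (intro j_leq_closed) auto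
    moreover have "j \<cdot> conj p (chr E t m) = p" using p m'
      by (simp add: j_conj flip: leq_iff_conj)
    ultimately show ?thesis by simp
  qed
  show ?thesis using *[OF p q eq] *[OF q p eq[symmetric]] p q by (intro leq_antisym) auto
qed

lemma de_morgan_dense_iff:
  "de_morgan_dense E t j \<longleftrightarrow>
    (\<forall>p. pred p \<longrightarrow> j \<cdot> disj (neg p) (neg (neg p)) = tru (src E p))"
proof -
  have dense: "jdense E t j ((\<sim>\<^bsub>Sub E X\<^esub> m) \<squnion>\<^bsub>Sub E X\<^esub> (\<sim>\<^bsub>Sub E X\<^esub> (\<sim>\<^bsub>Sub E X\<^esub> m))) \<longleftrightarrow>
      j \<cdot> disj (neg (chr E t m)) (neg (neg (chr E t m))) = tru X"
    if m: "m \<in> carrier (Sub E X)" for X m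
    using Sub_join[OF Sub_pcomp(1)[OF m] Sub_pcomp(1)[OF Sub_pcomp(1)[OF m]]]
      Sub_pcomp(2)[OF m] Sub_pcomp(2)[OF Sub_pcomp(1)[OF m]]
    by (simp add: jdense_iff)
  show ?thesis
  proof
    assume *: "de_morgan_dense E t j"
    show "\<forall>p. pred p \<longrightarrow> j \<cdot> disj (neg p) (neg (neg p)) = tru (src E p)"
    proof (intro allI impI)
      fix p assume p: "pred p"
      then have s: "subob p \<in> carrier (Sub E (src E p))" "src E p \<in> obj E" by simp_all
      then show "j \<cdot> disj (neg p) (neg (neg p)) = tru (src E p)"
        using dense[OF s(1)] * p unfolding de_morgan_dense_def by (simp del: Sub_simps)
    qed
  next
    assume "\<forall>p. pred p \<longrightarrow> j \<cdot> disj (neg p) (neg (neg p)) = tru (src E p)"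
    then show "de_morgan_dense E t j"
      unfolding de_morgan_dense_def using dense by (auto simp del: Sub_simps(2))
  qed
qed

text \<open>Closed predicates extend along every monomorphism, dense or not: take the direct image and close it.
This makes \<open>\<Omega>\<^sub>j\<close> injective.\<close>

lemma closed_extends:
  assumes m: "monic E m" and p: "pred p" "src E p = src E m" "j \<cdot> p = p"
  obtains q where "pred q" "src E q = tgt E m" "j \<cdot> q = q" "q \<cdot> m = p"
proof (rule that)
  let ?n = "m \<cdot> subob p"
  have n: "monic E ?n" using m p by (intro monic_cmp) auto
  let ?q = "chr E t ?n"
  have "?q \<cdot> m = p"
  proof (rule pred_eqI)
    fix f assume f: "f \<in> arr E" "tgt E f = src E p"
    have "factors (m \<cdot> f) ?n \<longleftrightarrow> factors f (subob p)"
    proof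
      assume "factors (m \<cdot> f) ?n"
      then obtain h where h: "h \<in> arr E" "src E h = src E f" "tgt E h = src E (subob p)" "?n \<cdot> h = m \<cdot> f"
        using f m p by (auto simp: factors_def)
      have "subob p \<cdot> h = f" by (rule monicD[OF m]) (use h m p f in auto)
      then show "factors f (subob p)" using h by (auto simp: factors_def)
    next
      assume "factors f (subob p)"
      then obtain h where "h \<in> arr E" "src E h = src E f" "tgt E h = src E (subob p)" "subob p \<cdot> h = f"
        by (auto simp: factors_def)
      then show "factors (m \<cdot> f) ?n" using m p f unfolding factors_def by (intro bexI[of _ h]) auto
    qed
    then show "holds (?q \<cdot> m) f \<longleftrightarrow> holds p f" using n m p f by (simp add: factors_subob)
  qed (use n m p in auto)
  then show "(j \<cdot> ?q) \<cdot> m = p" using n m p by simp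
  show "pred (j \<cdot> ?q)" "src E (j \<cdot> ?q) = tgt E m" "j \<cdot> j \<cdot> ?q = j \<cdot> ?q" using n m p by auto
qed

section \<open>Sheaves\<close>

lemma sheaf_obj [simp]: "is_sheaf E t j F \<Longrightarrow> F \<in> obj E"
  by (simp add: is_sheaf_def)

lemma sheaf_ext:
  assumes "is_sheaf E t j F" "jdense E t j m" "f \<in> arr E" "src E f = src E m" "tgt E f = F"
  obtains g where "g \<in> arr E" "src E g = tgt E m" "tgt E g = F" "g \<cdot> m = f"
proof -
  have "f \<in> Hom E (src E m) F" using assms by simp
  then obtain g where "g \<in> Hom E (tgt E m) F" "g \<cdot> m = f"
    using assms unfolding is_sheaf_def by blast
  then show thesis by (intro that[of g]) simp_all
qed

lemma sheaf_eqI: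
  assumes "is_sheaf E t j F" "jdense E t j m" "f \<in> arr E" "src E f = tgt E m" "tgt E f = F"
    "g \<in> arr E" "src E g = tgt E m" "tgt E g = F" "f \<cdot> m = g \<cdot> m"
  shows "f = g"
proof -
  have "m \<in> arr E" using assms by (simp add: jdense_def)
  then have "g \<cdot> m \<in> Hom E (src E m) F" using assms by simp
  then have "\<exists>!h. h \<in> Hom E (tgt E m) F \<and> h \<cdot> m = g \<cdot> m" using assms unfolding is_sheaf_def by blast
  then show ?thesis using assms by auto
qed

lemma sheafI:
  assumes "F \<in> obj E"
   "\<And>m f. jdense E t j m \<Longrightarrow> monic E m \<Longrightarrow> f \<in> arr E \<Longrightarrow> src E f = src E m \<Longrightarrow> tgt E f = F \<Longrightarrow>
     \<exists>g\<in>arr E. src E g = tgt E m \<and> tgt E g = F \<and> g \<cdot> m = f"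
   "\<And>m f g. jdense E t j m \<Longrightarrow> monic E m \<Longrightarrow> f \<in> arr E \<Longrightarrow> g \<in> arr E \<Longrightarrow> src E f = tgt E m \<Longrightarrow>
     src E g = tgt E m \<Longrightarrow> tgt E f = F \<Longrightarrow> tgt E g = F \<Longrightarrow> f \<cdot> m = g \<cdot> m \<Longrightarrow> f = g"
  shows "is_sheaf E t j F"
  unfolding is_sheaf_def
proof (intro conjI allI impI)
  fix m f assume *: "jdense E t j m \<and> f \<in> Hom E (src E m) F"
  then have m: "monic E m" by (simp add: jdense_def)
  obtain g where g: "g \<in> arr E" "src E g = tgt E m" "tgt E g = F" "g \<cdot> m = f"
    using assms(2)[of m f] * m unfolding in_Hom by blast
  show "\<exists>!g. g \<in> Hom E (tgt E m) F \<and> g \<cdot> m = f"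
  proof (rule ex1I[of _ g])
    fix h assume "h \<in> Hom E (tgt E m) F \<and> h \<cdot> m = f"
    then have "h \<in> arr E" "src E h = tgt E m" "tgt E h = F" "h \<cdot> m = f" by simp_all
    with * m g show "h = g" using assms(3)[of m h g] by simp
  qed (use g in simp)
qed fact

text \<open>The inclusion \<open>\<Omega>\<^sub>j \<rightarrow> \<Omega>\<close> of the closed truth values; maps into \<open>\<Omega>\<^sub>j\<close> are the closed predicates.\<close>

definition omega_j :: 'a where
  "omega_j = eqz j (idt E \<Omega>)"

lemma omega_j_simps [simp]:
  "monic E omega_j" "tgt E omega_j = \<Omega>"
  "p \<in> arr E \<Longrightarrow> tgt E p = \<Omega> \<Longrightarrow> factors p omega_j \<longleftrightarrow> j \<cdot> p = p"
  "j \<cdot> omega_j = omega_j"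
proof -
  have O: "\<Omega> \<in> obj E" by simp
  then show *: "monic E omega_j" "tgt E omega_j = \<Omega>"
    "p \<in> arr E \<Longrightarrow> tgt E p = \<Omega> \<Longrightarrow> factors p omega_j \<longleftrightarrow> j \<cdot> p = p"
    by (simp_all add: omega_j_def factors_eqz)
  show "j \<cdot> omega_j = omega_j"
    using eqz_eq[of j "idt E \<Omega>"] * O by (simp add: omega_j_def)
qed

lemma sheaf_omega_j: "is_sheaf E t j (src E omega_j)"
proof (rule sheafI)
  fix m f assume m: "jdense E t j m" "monic E m" and f: "f \<in> arr E" "src E f = src E m" "tgt E f = src E omega_j"
  have "j \<cdot> omega_j \<cdot> f = omega_j \<cdot> f" using cmp_extend[of j omega_j omega_j f] f by simp
  then obtain q where q: "pred q" "src E q = tgt E m" "j \<cdot> q = q" "q \<cdot> m = omega_j \<cdot> f"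
    using closed_extends[OF m(2), of "omega_j \<cdot> f"] f by auto
  then have "factors q omega_j" by simp
  then obtain g where g: "g \<in> arr E" "src E g = tgt E m" "tgt E g = src E omega_j" "omega_j \<cdot> g = q"
    using q by (auto simp: factors_def)
  have "omega_j \<cdot> (g \<cdot> m) = omega_j \<cdot> f" using cmp_extend[OF g(4), of m] g m q by simp
  then have "g \<cdot> m = f" by - (rule monicD[of omega_j "g \<cdot> m" f]; (use g m f in auto))
  then show "\<exists>g\<in>arr E. src E g = tgt E m \<and> tgt E g = src E omega_j \<and> g \<cdot> m = f" using g by blast
next
  fix m f g assume m: "jdense E t j m" "monic E m" and f: "f \<in> arr E" "g \<in> arr E" "src E f = tgt E m"
     "src E g = tgt E m" "tgt E f = src E omega_j" "tgt E g = src E omega_j" "f \<cdot> m = g \<cdot> m"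
  have "omega_j \<cdot> f = omega_j \<cdot> g"
    by (rule closed_eq_if_dense[OF m(1)])
      (use m f cmp_extend[of j omega_j omega_j] cmp_extend[of omega_j f "omega_j \<cdot> g" m] in simp_all)
  then show "f = g" by - (rule monicD[of omega_j f g]; (use f in auto))
qed auto

lemma equal_if_dense_equalizer:
  assumes F: "is_sheaf E t j F" and f: "f \<in> arr E" "tgt E f = F" and g: "g \<in> arr E" "tgt E g = F"
    and src: "src E f = src E g" and d: "j \<cdot> eqp f g = tru (src E g)"
  shows "f = g"
proof (rule sheaf_eqI[OF F, of "eqz f g"])
  show "jdense E t j (eqz f g)" using d f g src by (simp add: jdense_iff eqp_def)
  show "f \<cdot> eqz f g = g \<cdot> eqz f g" by (rule eqz_eq) (use f g src in auto)
qed (use f g src in auto)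

text \<open>Sheaves are separated: two maps into \<open>F\<close> that agree densely are equal.\<close>

lemma closed_diagonal:
  assumes F: "is_sheaf E t j F"
  shows "j \<cdot> eqp (pr1 E F F) (pr2 E F F) = eqp (pr1 E F F) (pr2 E F F)"
proof (rule leq_antisym)
  let ?e = "eqp (pr1 E F F) (pr2 E F F)"
  have Fo: "F \<in> obj E" using F by simp
  show "j \<cdot> ?e \<preceq> ?e"
    unfolding leq_def
  proof (intro allI impI)
    fix f assume f: "f \<in> arr E" "tgt E f = src E (j \<cdot> ?e)" "holds (j \<cdot> ?e) f"
    have f': "tgt E f = prod_obj E F F" using f Fo by simp
    have eq: "?e \<cdot> f = eqp (pr1 E F F \<cdot> f) (pr2 E F F \<cdot> f)"
      by (rule pred_eqI) (use f f' Fo in auto)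
    have "j \<cdot> ?e \<cdot> f = tru (src E f)" using f f' Fo by (simp add: holds_def)
    then have "pr1 E F F \<cdot> f = pr2 E F F \<cdot> f"
      by - (rule equal_if_dense_equalizer[OF F]; (use f(1) f' Fo eq in simp_all))
    then show "holds ?e f" using f f' Fo by simp
  qed
qed (use F in auto)

text \<open>\<open>I = \<Omega>\<^sub>j\<^bsup>A\<^esup>\<close>. Maps \<open>X \<rightarrow> I\<close> correspond to closed predicates on \<open>X \<times> A\<close>, so extending them along
\<open>m\<close> amounts to extending closed predicates along \<open>m \<times> 1\<close>, which is monic, and dense when \<open>m\<close> is.
The embedding of a sheaf \<open>A\<close> is the transpose of its diagonal, the singleton map.\<close>

lemma sheaf_power:
  assumes A: "A \<in> obj E"
  obtains I where "is_sheaf E t j I"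
    "\<And>m f. monic E m \<Longrightarrow> f \<in> arr E \<Longrightarrow> src E f = src E m \<Longrightarrow> tgt E f = I \<Longrightarrow>
       \<exists>g\<in>arr E. src E g = tgt E m \<and> tgt E g = I \<and> g \<cdot> m = f"
    "is_sheaf E t j A \<Longrightarrow> \<exists>s. monic E s \<and> src E s = A \<and> tgt E s = I"
proof -
  obtain I ev where I: "I \<in> obj E" and ev: "ev \<in> arr E" "src E ev = prod_obj E I A" "tgt E ev = src E omega_j"
    and ex: "\<And>X f. X \<in> obj E \<Longrightarrow> f \<in> arr E \<Longrightarrow> src E f = prod_obj E X A \<Longrightarrow> tgt E f = src E omega_j \<Longrightarrow>
      \<exists>g\<in>arr E. src E g = X \<and> tgt E g = I \<and> ev \<cdot> prod_arr E g (idt E A) = f"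
    and un: "\<And>g g'. g \<in> arr E \<Longrightarrow> g' \<in> arr E \<Longrightarrow> src E g = src E g' \<Longrightarrow> tgt E g = I \<Longrightarrow> tgt E g' = I \<Longrightarrow>
      ev \<cdot> prod_arr E g (idt E A) = ev \<cdot> prod_arr E g' (idt E A) \<Longrightarrow> g = g'"
    by (rule exponential[OF A, of "src E omega_j"]) (simp, rule that)
  \<comment> \<open>The closed predicate on \<open>X \<times> A\<close> that corresponds to \<open>g : X \<rightarrow> I\<close>.\<close>
  define \<epsilon> where "\<epsilon> g = omega_j \<cdot> ev \<cdot> prod_arr E g (idt E A)" for g
  have \<epsilon>_simps [simp]: "\<epsilon> g \<in> arr E" "src E (\<epsilon> g) = prod_obj E (src E g) A" "tgt E (\<epsilon> g) = \<Omega>" "j \<cdot> \<epsilon> g = \<epsilon> g"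
    if "g \<in> arr E" "tgt E g = I" for g
    using that A ev I cmp_extend[of j omega_j omega_j "ev \<cdot> prod_arr E g (idt E A)"] by (simp_all add: \<epsilon>_def del: prod_arr_cmp)
  have \<epsilon>_ex: "\<exists>g\<in>arr E. src E g = X \<and> tgt E g = I \<and> \<epsilon> g = q"
    if X: "X \<in> obj E" and q: "pred q" "src E q = prod_obj E X A" "j \<cdot> q = q" for X q
  proof -
    have "factors q omega_j" using q by simp
    then obtain h where h: "h \<in> arr E" "src E h = prod_obj E X A" "tgt E h = src E omega_j" "omega_j \<cdot> h = q"
      using q by (auto simp: factors_def)
    then show ?thesis using ex[OF X h(1-3)] by (auto simp: \<epsilon>_def)
  qed
  have \<epsilon>_inj: "g = g'" if "g \<in> arr E" "g' \<in> arr E" "src E g = src E g'" "tgt E g = I" "tgt E g' = I" "\<epsilon> g = \<epsilon> g'" for g g'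
  proof (rule un)
    show "ev \<cdot> prod_arr E g (idt E A) = ev \<cdot> prod_arr E g' (idt E A)"
      by (rule monicD[of omega_j]) (use that A ev in \<open>simp_all add: \<epsilon>_def del: prod_arr_cmp\<close>)
  qed (use that in auto)
  have \<epsilon>_cmp: "\<epsilon> (g \<cdot> f) = \<epsilon> g \<cdot> prod_arr E f (idt E A)"
    if "f \<in> arr E" "g \<in> arr E" "src E g = tgt E f" "tgt E g = I" for f g
    using that A ev by (simp add: \<epsilon>_def prod_arr_cmp_left del: prod_arr_cmp)
  have monic_times: "monic E (prod_arr E m (idt E A))" if m: "monic E m" for m
  proof (rule monicI)
    fix f g assume fg: "f \<in> arr E" "g \<in> arr E" "src E f = src E g" "tgt E f = src E (prod_arr E m (idt E A))"
      "tgt E g = src E (prod_arr E m (idt E A))" "prod_arr E m (idt E A) \<cdot> f = prod_arr E m (idt E A) \<cdot> g"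
    have fg': "tgt E f = prod_obj E (src E m) A" "tgt E g = prod_obj E (src E m) A" using fg m A by auto
    let ?a = "pr1 E (src E m) A" and ?b = "pr2 E (src E m) A"
    have eq: "pairing E (m \<cdot> ?a \<cdot> f) (?b \<cdot> f) = pairing E (m \<cdot> ?a \<cdot> g) (?b \<cdot> g)"
      using fg fg' m A by simp
    have "m \<cdot> ?a \<cdot> f = pr1 E (tgt E m) A \<cdot> pairing E (m \<cdot> ?a \<cdot> f) (?b \<cdot> f)"
      using fg(1-3) fg' m A by simp
    also have "\<dots> = m \<cdot> ?a \<cdot> g" unfolding eq using fg(1-3) fg' m A by simp
    finally have 1: "?a \<cdot> f = ?a \<cdot> g" by - (rule monicD[OF m]; (use fg fg' m A in auto))
    have "?b \<cdot> f = pr2 E (tgt E m) A \<cdot> pairing E (m \<cdot> ?a \<cdot> f) (?b \<cdot> f)"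
      using fg(1-3) fg' m A by simp
    also have "\<dots> = ?b \<cdot> g" unfolding eq using fg(1-3) fg' m A by simp
    finally show "f = g" using 1 by - (rule pairing_eqI[where A = "src E m" and B = A]; (use fg fg' m A in auto))
  qed (use m A in auto)
  have inj: "\<exists>g\<in>arr E. src E g = tgt E m \<and> tgt E g = I \<and> g \<cdot> m = f"
    if m: "monic E m" and f: "f \<in> arr E" "src E f = src E m" "tgt E f = I" for m f
  proof -
    obtain q where q: "pred q" "src E q = prod_obj E (tgt E m) A" "j \<cdot> q = q" "q \<cdot> prod_arr E m (idt E A) = \<epsilon> f"
      using closed_extends[OF monic_times[OF m], of "\<epsilon> f"] f m A by (auto simp del: prod_arr_cmp)
    then obtain g where g: "g \<in> arr E" "src E g = tgt E m" "tgt E g = I" "\<epsilon> g = q"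
      using \<epsilon>_ex[of "tgt E m" q] m by auto
    have "g \<cdot> m = f" by (rule \<epsilon>_inj) (use g m f q in \<open>simp_all add: \<epsilon>_cmp del: prod_arr_cmp\<close>)
    then show ?thesis using g by blast
  qed
  have dense_times: "jdense E t j (prod_arr E m (idt E A))" if m: "jdense E t j m" for m
  proof -
    have m': "monic E m" "j \<cdot> chr E t m = tru (tgt E m)" using m by (auto simp: jdense_iff)
    have "chr E t (prod_arr E m (idt E A)) = chr E t m \<cdot> pr1 E (tgt E m) A"
    proof (rule chr_cmp_eq)
      fix g assume "g \<in> arr E" "tgt E g = src E (pr1 E (tgt E m) A)"
      then have g: "g \<in> arr E" "tgt E g = prod_obj E (tgt E m) A" using m' A by auto
      show "factors g (prod_arr E m (idt E A)) \<longleftrightarrow> factors (pr1 E (tgt E m) A \<cdot> g) m"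
      proof
        assume "factors g (prod_arr E m (idt E A))"
        then obtain h where h: "h \<in> arr E" "src E h = src E g" "tgt E h = src E (prod_arr E m (idt E A))"
          "prod_arr E m (idt E A) \<cdot> h = g" unfolding factors_def by blast
        have h': "tgt E h = prod_obj E (src E m) A" using h(3) m' A by simp
        have "pr1 E (tgt E m) A \<cdot> prod_arr E m (idt E A) \<cdot> h = m \<cdot> pr1 E (src E m) A \<cdot> h"
          using h(1) h' m' A by simp
        then have "m \<cdot> pr1 E (src E m) A \<cdot> h = pr1 E (tgt E m) A \<cdot> g" unfolding h(4) by simp
        then show "factors (pr1 E (tgt E m) A \<cdot> g) m"
          using h(1,2) h' m' g A unfolding factors_def by (intro bexI[of _ "pr1 E (src E m) A \<cdot> h"]) simp_all
      next
        assume "factors (pr1 E (tgt E m) A \<cdot> g) m"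
        then obtain h where h: "h \<in> arr E" "src E h = src E g" "tgt E h = src E m" "m \<cdot> h = pr1 E (tgt E m) A \<cdot> g"
          using g m' A by (auto simp: factors_def)
        then show "factors g (prod_arr E m (idt E A))"
          using g m' A unfolding factors_def
          by (intro bexI[of _ "pairing E h (pr2 E (tgt E m) A \<cdot> g)"]) auto
      qed
    qed (use m' A monic_times in auto)
    then show ?thesis
      using m' A monic_times[OF m'(1)] cmp_extend[OF m'(2), of "pr1 E (tgt E m) A"] by (simp add: jdense_iff)
  qed
  have sheaf: "is_sheaf E t j I"
  proof (rule sheafI[OF I])
    fix m f g assume m: "jdense E t j m" "monic E m" and f: "f \<in> arr E" "g \<in> arr E" "src E f = tgt E m"
       "src E g = tgt E m" "tgt E f = I" "tgt E g = I" "f \<cdot> m = g \<cdot> m"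
    have "\<epsilon> f \<cdot> prod_arr E m (idt E A) = \<epsilon> g \<cdot> prod_arr E m (idt E A)"
      using f m by (simp del: prod_arr_cmp flip: \<epsilon>_cmp)
    then have "\<epsilon> f = \<epsilon> g" by - (rule closed_eq_if_dense[OF dense_times[OF m(1)]]; (use f m A in auto))
    then show "f = g" by - (rule \<epsilon>_inj; (use f in auto))
  qed (use inj in blast)
  have singleton: "\<exists>s. monic E s \<and> src E s = A \<and> tgt E s = I" if F: "is_sheaf E t j A"
  proof -
    let ?e = "eqp (pr1 E A A) (pr2 E A A)"
    obtain s where s: "s \<in> arr E" "src E s = A" "tgt E s = I" "\<epsilon> s = ?e"
      using \<epsilon>_ex[OF A, of ?e] closed_diagonal[OF F] A by auto
    have "monic E s"
    proof (rule monicI)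
      fix f g assume fg: "f \<in> arr E" "g \<in> arr E" "src E f = src E g" "tgt E f = src E s" "tgt E g = src E s" "s \<cdot> f = s \<cdot> g"
      \<comment> \<open>Evaluating the singletons of \<open>f\<close> and \<open>g\<close> at \<open>g\<close> shows that \<open>f = g\<close> holds because \<open>g = g\<close> does.\<close>
      let ?d = "pairing E (idt E (src E g)) g"
      have "?e \<cdot> prod_arr E f (idt E A) = ?e \<cdot> prod_arr E g (idt E A)"
        using s fg A \<epsilon>_cmp[of f s] \<epsilon>_cmp[of g s] by simp
      then have "(?e \<cdot> prod_arr E f (idt E A)) \<cdot> ?d = (?e \<cdot> prod_arr E g (idt E A)) \<cdot> ?d" by simp
      then have *: "?e \<cdot> pairing E f g = ?e \<cdot> pairing E g g" using s fg A by simp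
      have "holds ?e (pairing E g g)" using fg s A by simp
      then have "holds ?e (pairing E f g)" using * fg s A by (simp add: holds_def)
      then show "f = g" using fg s A by simp
    qed (use s in auto)
    then show ?thesis using s by blast
  qed
  show thesis by (rule that[OF sheaf inj singleton])
qed

text \<open>An extension of \<open>f\<close> computed in \<open>F\<close> lands in the subobject, since it does so densely and \<open>p\<close> is closed.\<close>

lemma closed_subobject_sheaf:
  assumes F: "is_sheaf E t j F" and p: "pred p" "src E p = F" "j \<cdot> p = p"
  shows "is_sheaf E t j (src E (subob p))"
proof (rule sheafI)
  have s: "monic E (subob p)" "tgt E (subob p) = F" using p by auto
  fix m f assume m: "jdense E t j m" "monic E m" and f: "f \<in> arr E" "src E f = src E m" "tgt E f = src E (subob p)"
  obtain g where g: "g \<in> arr E" "src E g = tgt E m" "tgt E g = F" "g \<cdot> m = subob p \<cdot> f"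
    using sheaf_ext[OF F m(1), of "subob p \<cdot> f"] f m s by auto
  have "factors (subob p \<cdot> f) (subob p)" using f s unfolding factors_def by (intro bexI[of _ f]) auto
  then have "holds p (subob p \<cdot> f)" using f s p by (simp add: factors_subob)
  then have "p \<cdot> g \<cdot> m = tru (src E m)" using f s g by (simp add: holds_def)
  then have "p \<cdot> g = tru (tgt E m)"
    by - (rule closed_eq_if_dense[OF m(1)]; (use m g p f s cmp_extend[OF p(3), of g] in simp_all))
  then have "factors g (subob p)" using g p by (simp add: factors_subob holds_def)
  then obtain h where h: "h \<in> arr E" "src E h = tgt E m" "tgt E h = src E (subob p)" "subob p \<cdot> h = g"
    using g by (auto simp: factors_def)
  have "subob p \<cdot> h \<cdot> m = subob p \<cdot> f" using cmp_extend[OF h(4), of m] h m s g by simp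
  then have "h \<cdot> m = f" by - (rule monicD[OF s(1)]; (use h m f in auto))
  then show "\<exists>g\<in>arr E. src E g = tgt E m \<and> tgt E g = src E (subob p) \<and> g \<cdot> m = f" using h by blast
next
  have s: "monic E (subob p)" "tgt E (subob p) = F" using p by auto
  fix m f g assume m: "jdense E t j m" "monic E m" and f: "f \<in> arr E" "g \<in> arr E" "src E f = tgt E m"
     "src E g = tgt E m" "tgt E f = src E (subob p)" "tgt E g = src E (subob p)" "f \<cdot> m = g \<cdot> m"
  have "subob p \<cdot> f = subob p \<cdot> g"
    by (rule sheaf_eqI[OF F m(1)]) (use m f s in auto)
  then show "f = g" by - (rule monicD[OF s(1)]; (use f in auto))
qed (use p in auto)

text \<open>The inclusion \<open>i\<close> of \<open>m\<close> into its closure \<open>c\<close> is dense. As the domain of \<open>m\<close> is a sheaf, its identity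
extends to a retraction \<open>r\<close> of \<open>i\<close>; then \<open>m \<cdot> r = c\<close> since both agree on the dense \<open>i\<close>.\<close>

lemma sheaf_subobject_closed:
  assumes F: "is_sheaf E t j F" and m: "monic E m" "tgt E m = F" and S: "is_sheaf E t j (src E m)"
  shows "j \<cdot> chr E t m = chr E t m"
proof (rule leq_antisym)
  let ?p = "chr E t m"
  let ?c = "subob (j \<cdot> ?p)"
  have c: "monic E ?c" "tgt E ?c = F" "chr E t ?c = j \<cdot> ?p" using m by auto
  have "?p \<preceq> chr E t ?c" using c m by simp
  then have "factors m ?c" using factors_iff_leq[OF m(1) c(1)] m c by simp
  then obtain i where i: "i \<in> arr E" "src E i = src E m" "tgt E i = src E ?c" "?c \<cdot> i = m"
    by (auto simp: factors_def)
  have im: "monic E i"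
  proof (rule monicI)
    fix f g assume fg: "f \<in> arr E" "g \<in> arr E" "src E f = src E g" "tgt E f = src E i" "tgt E g = src E i" "i \<cdot> f = i \<cdot> g"
    have "m \<cdot> f = m \<cdot> g"
      using fg i c cmp_extend[OF i(4), of f] cmp_extend[OF i(4), of g] by simp
    then show "f = g" by - (rule monicD[OF m(1)]; (use fg i in auto))
  qed (use i in auto)
  have ch: "chr E t i = ?p \<cdot> ?c"
  proof (rule chr_cmp_eq)
    fix g assume g: "g \<in> arr E" "tgt E g = src E ?c"
    show "factors g i \<longleftrightarrow> factors (?c \<cdot> g) m"
    proof
      assume "factors g i"
      then obtain h where h: "h \<in> arr E" "src E h = src E g" "tgt E h = src E i" "i \<cdot> h = g"
        by (auto simp: factors_def)
      have "m \<cdot> h = ?c \<cdot> g" using cmp_extend[OF i(4), of h] h i c by simp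
      then show "factors (?c \<cdot> g) m" using h i g c unfolding factors_def by (intro bexI[of _ h]) auto
    next
      assume "factors (?c \<cdot> g) m"
      then obtain h where h: "h \<in> arr E" "src E h = src E g" "tgt E h = src E m" "m \<cdot> h = ?c \<cdot> g"
        using g c by (auto simp: factors_def)
      have "?c \<cdot> i \<cdot> h = ?c \<cdot> g" using cmp_extend[OF i(4), of h] h i c by simp
      then have "i \<cdot> h = g" by - (rule monicD[OF c(1)]; (use h i g in auto))
      then show "factors g i" using h i unfolding factors_def by (intro bexI[of _ h]) auto
    qed
  qed (use im i m c in auto)
  have "holds (j \<cdot> ?p) ?c" using factors_subob[of "j \<cdot> ?p" ?c] factors_refl[of ?c] m c by simp
  then have "j \<cdot> ?p \<cdot> ?c = tru (src E ?c)" using m c by (simp add: holds_def)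
  then have d: "jdense E t j i" using im i by (simp add: jdense_iff ch)
  obtain r where r: "r \<in> arr E" "src E r = src E ?c" "tgt E r = src E m" "r \<cdot> i = idt E (src E m)"
    using sheaf_ext[OF S d, of "idt E (src E m)"] i m by auto
  have "m \<cdot> r = ?c"
    by (rule sheaf_eqI[OF F d]) (use r i m c in auto)
  then have "factors ?c m" using r m unfolding factors_def by (intro bexI[of _ r]) auto
  then show "j \<cdot> ?p \<preceq> ?p" using factors_iff_leq[OF c(1) m(1)] m c by simp
qed (use m in auto)

lemma sh_simps [simp]:
  "obj (sh E t j) = {F. is_sheaf E t j F}"
  "arr (sh E t j) = {f \<in> arr E. is_sheaf E t j (src E f) \<and> is_sheaf E t j (tgt E f)}"
  "src (sh E t j) = src E" "tgt (sh E t j) = tgt E" "cmp (sh E t j) = cmp E"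
  by (auto simp: sh_def full_subcat_def)

end

section \<open>Sheafification\<close>

locale sheafification = local_op E t j
  for E :: "('o, 'a) cat" (structure) and t j :: 'a +
  fixes ao :: "'o \<Rightarrow> 'o" and aa :: "'a \<Rightarrow> 'a" and \<eta> :: "'o \<Rightarrow> 'a"
  assumes sheafification: "associated_sheaf_functor E t j ao aa \<eta>"
begin

lemma ao_sheaf [simp]: "X \<in> obj E \<Longrightarrow> is_sheaf E t j (ao X)"
  using sheafification by (auto simp: associated_sheaf_functor_def is_functor_def)

lemma aa_simps [simp]:
  assumes "f \<in> arr E"
  shows "aa f \<in> arr E" "src E (aa f) = ao (src E f)" "tgt E (aa f) = ao (tgt E f)"
    and aa_natural: "aa f \<cdot> \<eta> (src E f) = \<eta> (tgt E f) \<cdot> f"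
  using sheafification assms by (auto simp: associated_sheaf_functor_def is_functor_def)

lemma \<eta>_simps [simp]:
  assumes "X \<in> obj E"
  shows "\<eta> X \<in> arr E" "src E (\<eta> X) = X" "tgt E (\<eta> X) = ao X"
  using sheafification assms by (auto simp: associated_sheaf_functor_def)

lemma \<eta>_ex1:
  assumes "is_sheaf E t j F" "f \<in> arr E" "tgt E f = F"
  shows "\<exists>!g. g \<in> Hom (sh E t j) (ao (src E f)) F \<and> g \<cdot> \<eta> (src E f) = f"
proof -
  have "src E f \<in> obj E" "F \<in> obj (sh E t j)" "f \<in> Hom E (src E f) F" using assms by auto
  then show ?thesis
    using sheafification unfolding associated_sheaf_functor_def by blast
qed

lemma \<eta>_ext:
  assumes "is_sheaf E t j F" "f \<in> arr E" "tgt E f = F" "src E f = X"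
  obtains g where "g \<in> arr E" "src E g = ao X" "tgt E g = F" "g \<cdot> \<eta> X = f"
  using \<eta>_ex1[OF assms(1-3)] assms(4) by auto

lemma \<eta>_eqI:
  assumes F: "is_sheaf E t j F" and X: "X \<in> obj E" and f: "f \<in> arr E" "src E f = ao X" "tgt E f = F"
    and g: "g \<in> arr E" "src E g = ao X" "tgt E g = F" and eq: "f \<cdot> \<eta> X = g \<cdot> \<eta> X"
  shows "f = g"
proof -
  have "\<exists>!h. h \<in> Hom (sh E t j) (ao X) F \<and> h \<cdot> \<eta> X = g \<cdot> \<eta> X"
    using \<eta>_ex1[OF F, of "g \<cdot> \<eta> X"] g X by simp
  moreover have "f \<in> Hom (sh E t j) (ao X) F" "g \<in> Hom (sh E t j) (ao X) F" using f g F X by simp_all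
  ultimately show ?thesis using eq by blast
qed

text \<open>The universal property of \<open>\<eta>\<close> applied to the sheaf \<open>\<Omega>\<^sub>j\<close>: this lemma and the next make pulling back
along \<open>\<eta>\<close> a bijection of closed predicates.\<close>

lemma closed_transfer:
  assumes p: "pred p" "j \<cdot> p = p"
  obtains q where "pred q" "src E q = ao (src E p)" "j \<cdot> q = q" "q \<cdot> \<eta> (src E p) = p"
proof -
  have "factors p omega_j" using p by simp
  then obtain h where h: "h \<in> arr E" "src E h = src E p" "tgt E h = src E omega_j" "omega_j \<cdot> h = p"
    by (auto simp: factors_def)
  obtain g where g: "g \<in> arr E" "src E g = ao (src E p)" "tgt E g = src E omega_j" "g \<cdot> \<eta> (src E p) = h"
    using \<eta>_ext[OF sheaf_omega_j h(1,3,2)] .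
  show thesis
    by (rule that[of "omega_j \<cdot> g"]) (use h g p cmp_extend[of j omega_j omega_j g] in simp_all)
qed

lemma closed_\<eta>_eqI:
  assumes X: "X \<in> obj E" and p: "pred p" "src E p = ao X" "j \<cdot> p = p"
    and q: "pred q" "src E q = ao X" "j \<cdot> q = q" and eq: "p \<cdot> \<eta> X = q \<cdot> \<eta> X"
  shows "p = q"
proof -
  have "factors p omega_j" "factors q omega_j" using p q by simp_all
  then obtain h k where h: "h \<in> arr E" "src E h = src E p" "tgt E h = src E omega_j" "omega_j \<cdot> h = p"
   and k: "k \<in> arr E" "src E k = src E q" "tgt E k = src E omega_j" "omega_j \<cdot> k = q"
    by (auto simp: factors_def)
  have "omega_j \<cdot> h \<cdot> \<eta> X = omega_j \<cdot> k \<cdot> \<eta> X"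
    using cmp_extend[OF h(4), of "\<eta> X"] cmp_extend[OF k(4), of "\<eta> X"] h k p q eq X by simp
  then have "h \<cdot> \<eta> X = k \<cdot> \<eta> X" by - (rule monicD[of omega_j]; (use h k p q X in simp))
  then have "h = k" by - (rule \<eta>_eqI[OF sheaf_omega_j X]; (use h k p q in simp))
  then show ?thesis using h k by simp
qed

text \<open>Embed \<open>aS\<close> by \<open>s\<close> into an injective sheaf \<open>I\<close>. The composite \<open>s \<cdot> \<eta>\<close> extends along \<open>m : S \<rightarrow> X\<close> to \<open>X\<close> and
then along \<open>\<eta>\<close> to \<open>q : aX \<rightarrow> I\<close>. By the uniqueness of extensions \<open>q \<cdot> a(m) = s\<close>, so \<open>a(m)\<close> is a first
factor of a monomorphism.\<close>

lemma aa_monic: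
  assumes m: "monic E m"
  shows "monic E (aa m)"
proof -
  let ?S = "src E m" and ?X = "tgt E m"
  have obj: "?S \<in> obj E" "?X \<in> obj E" using m by auto
  obtain I where I: "is_sheaf E t j I"
    and inj: "\<And>m f. monic E m \<Longrightarrow> f \<in> arr E \<Longrightarrow> src E f = src E m \<Longrightarrow> tgt E f = I \<Longrightarrow>
       \<exists>g\<in>arr E. src E g = tgt E m \<and> tgt E g = I \<and> g \<cdot> m = f"
    and emb: "is_sheaf E t j (ao ?S) \<Longrightarrow> \<exists>s. monic E s \<and> src E s = ao ?S \<and> tgt E s = I"
    by (rule sheaf_power[of "ao ?S"]) (use obj in simp, rule that)
  obtain s where s: "monic E s" "src E s = ao ?S" "tgt E s = I" using emb obj by auto
  obtain p where p: "p \<in> arr E" "src E p = ?X" "tgt E p = I" "p \<cdot> m = s \<cdot> \<eta> ?S"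
    using inj[OF m, of "s \<cdot> \<eta> ?S"] s obj by auto
  obtain q where q: "q \<in> arr E" "src E q = ao ?X" "tgt E q = I" "q \<cdot> \<eta> ?X = p"
    using \<eta>_ext[OF I p(1,3,2)] .
  have "q \<cdot> \<eta> ?X \<cdot> m = s \<cdot> \<eta> ?S" using cmp_extend[OF q(4), of m] q p m obj by simp
  then have eq: "q \<cdot> aa m \<cdot> \<eta> ?S = s \<cdot> \<eta> ?S" using m by (simp add: aa_natural)
  have "q \<cdot> aa m = s"
    by (rule \<eta>_eqI[OF I, of ?S]) (use q s m obj eq in simp_all)
  note qs = this
  show ?thesis
  proof (rule monicI)
    fix f g assume fg: "f \<in> arr E" "g \<in> arr E" "src E f = src E g" "tgt E f = src E (aa m)"
      "tgt E g = src E (aa m)" "aa m \<cdot> f = aa m \<cdot> g"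
    have "s \<cdot> f = s \<cdot> g"
      using cmp_extend[OF qs, of f] cmp_extend[OF qs, of g] fg q m by simp
    then show "f = g" by - (rule monicD[OF s(1)]; (use fg s m in simp))
  qed (use m in simp)
qed

text \<open>One inequality is the naturality of \<open>\<eta>\<close>. For the other, the closure of \<open>m\<close> is \<open>d \<cdot> \<eta>\<close> for a closed
predicate \<open>d\<close> on \<open>aX\<close>. It is true on \<open>m\<close>, so \<open>d \<cdot> a(m)\<close> is true after composition with \<open>\<eta>\<close>, hence
true, and \<open>a(m)\<close> lies below \<open>d\<close>.\<close>

lemma chr_aa:
  assumes m: "monic E m"
  shows "j \<cdot> chr E t (aa m) = chr E t (aa m)" "chr E t (aa m) \<cdot> \<eta> (tgt E m) = j \<cdot> chr E t m"
proof -
  let ?S = "src E m" and ?X = "tgt E m"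
  have obj: "?S \<in> obj E" "?X \<in> obj E" using m by auto
  have am: "monic E (aa m)" using m by (rule aa_monic)
  show closed: "j \<cdot> chr E t (aa m) = chr E t (aa m)"
    by (rule sheaf_subobject_closed[of "ao ?X"]) (use am m obj in simp_all)
  obtain d where d: "pred d" "src E d = ao ?X" "j \<cdot> d = d" "d \<cdot> \<eta> ?X = j \<cdot> chr E t m"
    using closed_transfer[of "j \<cdot> chr E t m"] m obj by auto
  show "chr E t (aa m) \<cdot> \<eta> ?X = j \<cdot> chr E t m"
  proof (rule leq_antisym)
    have "chr E t m \<preceq> chr E t (aa m) \<cdot> \<eta> ?X"
      unfolding leq_def
    proof (intro allI impI)
      fix f assume f: "f \<in> arr E" "tgt E f = src E (chr E t m)" "holds (chr E t m) f"
      then have f': "tgt E f = ?X" "factors f m" using m by simp_all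
      then obtain h where h: "h \<in> arr E" "src E h = src E f" "tgt E h = ?S" "m \<cdot> h = f"
        by (auto simp: factors_def)
      have "aa m \<cdot> \<eta> ?S \<cdot> h = \<eta> ?X \<cdot> f"
        using cmp_extend[OF aa_natural[of m], of h] h m obj by simp
      then have "factors (\<eta> ?X \<cdot> f) (aa m)"
        using h m obj f f' unfolding factors_def by (intro bexI[of _ "\<eta> ?S \<cdot> h"]) simp_all
      then show "holds (chr E t (aa m) \<cdot> \<eta> ?X) f" using f f' am m obj by simp
    qed
    then show "j \<cdot> chr E t m \<preceq> chr E t (aa m) \<cdot> \<eta> ?X"
      using m am obj cmp_extend[OF closed, of "\<eta> ?X"] by (intro j_leq_closed) simp_all
  next
    have "d \<cdot> aa m = tru (ao ?S)"
    proof (rule closed_\<eta>_eqI[of ?S])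
      have "holds (chr E t m) m" using m factors_refl[of m] by simp
      then have "j \<cdot> chr E t m \<cdot> m = tru ?S" using m obj by (simp add: holds_def)
      then have "d \<cdot> \<eta> ?X \<cdot> m = tru ?S" using cmp_extend[OF d(4), of m] d m obj by simp
      then show "(d \<cdot> aa m) \<cdot> \<eta> ?S = tru (ao ?S) \<cdot> \<eta> ?S" using m d obj by (simp add: aa_natural)
      show "j \<cdot> d \<cdot> aa m = d \<cdot> aa m" using cmp_extend[OF d(3), of "aa m"] d m obj by simp
    qed (use d m obj in simp_all)
    then have daa: "holds d (aa m)" using m by (simp add: holds_def)
    have "chr E t (aa m) \<preceq> d"
      unfolding leq_def
    proof (intro allI impI)
      fix f assume f: "f \<in> arr E" "tgt E f = src E (chr E t (aa m))" "holds (chr E t (aa m)) f"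
      then have "factors f (aa m)" using am m by simp
      then obtain h where h: "h \<in> arr E" "src E h = src E f" "tgt E h = src E (aa m)" "aa m \<cdot> h = f"
        unfolding factors_def by blast
      have "holds d (aa m \<cdot> h)" by (rule holds_mono) (use h m d daa in simp_all)
      then show "holds d f" using h by simp
    qed
    then show "chr E t (aa m) \<cdot> \<eta> ?X \<preceq> j \<cdot> chr E t m"
      unfolding d(4)[symmetric] using d m am obj by (intro leq_cmp) simp_all
  qed (use m am obj in simp_all)
qed

subsection \<open>The subobject lattice of a sheaf\<close>

text \<open>Monomorphisms of sheaves are tested on sheaves only, but maps from any \<open>Y\<close> to a sheaf factor through
the sheaf \<open>aY\<close>.\<close>

lemma monic_sh_iff:
  "monic (sh E t j) m \<longleftrightarrow> monic E m \<and> is_sheaf E t j (src E m) \<and> is_sheaf E t j (tgt E m)"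
proof
  assume mono: "monic (sh E t j) m"
  then have m: "m \<in> arr E" "is_sheaf E t j (src E m)" "is_sheaf E t j (tgt E m)"
    unfolding monic_def sh_simps by blast+
  have "monic E m"
  proof (rule monicI)
    fix f g assume fg: "f \<in> arr E" "g \<in> arr E" "src E f = src E g" "tgt E f = src E m"
      "tgt E g = src E m" "m \<cdot> f = m \<cdot> g"
    let ?Y = "src E g"
    obtain f' where f': "f' \<in> arr E" "src E f' = ao ?Y" "tgt E f' = src E m" "f' \<cdot> \<eta> ?Y = f"
      using \<eta>_ext[OF m(2) fg(1,4,3)] .
    obtain g' where g': "g' \<in> arr E" "src E g' = ao ?Y" "tgt E g' = src E m" "g' \<cdot> \<eta> ?Y = g"
      using \<eta>_ext[OF m(2) fg(2,5) refl] .
    have Y: "?Y \<in> obj E" using fg by simp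
    have "m \<cdot> f' = m \<cdot> g'"
      by (rule \<eta>_eqI[OF m(3) Y]) (use f' g' m fg Y in simp_all)
    then have "f' = g'"
      using mono f' g' m Y unfolding monic_def sh_simps by fastforce
    then show "f = g" using f'(4) g'(4) by simp
  qed fact
  then show "monic E m \<and> is_sheaf E t j (src E m) \<and> is_sheaf E t j (tgt E m)" using m by simp
next
  assume "monic E m \<and> is_sheaf E t j (src E m) \<and> is_sheaf E t j (tgt E m)"
  then show "monic (sh E t j) m"
    unfolding monic_def sh_simps by blast
qed

lemma Sub_sh_presentation:
  assumes F: "is_sheaf E t j F"
  shows "order_presentation (Sub (sh E t j) F) (chr E t) {p. pred p \<and> src E p = F \<and> j \<cdot> p = p} leq"
proof
  have le: "le (Sub (sh E t j) F) m n \<longleftrightarrow> chr E t m \<preceq> chr E t n"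
    if "m \<in> carrier (Sub (sh E t j) F)" "n \<in> carrier (Sub (sh E t j) F)" for m n
  proof -
    have mn: "monic E m" "monic E n" "tgt E m = tgt E n" "is_sheaf E t j (src E m)" "is_sheaf E t j (src E n)"
      using that by (auto simp: monic_sh_iff)
    have "le (Sub (sh E t j) F) m n \<longleftrightarrow> factors m n"
    proof -
      have "h \<in> Hom (sh E t j) (src E m) (src E n) \<longleftrightarrow> h \<in> arr E \<and> src E h = src E m \<and> tgt E h = src E n" for h
        using mn(4,5) by auto
      then show ?thesis unfolding factors_def Sub_def Let_def Bex_def by (simp del: in_Hom)
    qed
    then show ?thesis using factors_iff_leq[OF mn(1-3)] by simp
  qed
  show "le (Sub (sh E t j) F) m n \<longleftrightarrow> chr E t m \<preceq> chr E t n"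
    if "m \<in> carrier (Sub (sh E t j) F)" "n \<in> carrier (Sub (sh E t j) F)" for m n
    using le that .
  show "eq (Sub (sh E t j) F) m n \<longleftrightarrow> chr E t m = chr E t n"
    if m: "m \<in> carrier (Sub (sh E t j) F)" and n: "n \<in> carrier (Sub (sh E t j) F)" for m n
  proof -
    have "monic E m" "monic E n" "tgt E m = F" "tgt E n = F"
      using m n by (auto simp: monic_sh_iff)
    then show ?thesis unfolding Sub_simps(2) le[OF m n] le[OF n m]
      using leq_antisym[of "chr E t m" "chr E t n"] by auto
  qed
  show "chr E t ` carrier (Sub (sh E t j) F) = {p. pred p \<and> src E p = F \<and> j \<cdot> p = p}"
  proof (intro equalityI subsetI)
    fix p assume "p \<in> {p. pred p \<and> src E p = F \<and> j \<cdot> p = p}"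
    then have p: "pred p" "src E p = F" "j \<cdot> p = p" by auto
    then have "subob p \<in> carrier (Sub (sh E t j) F)"
      using F closed_subobject_sheaf[OF F p] by (simp add: monic_sh_iff)
    then show "p \<in> chr E t ` carrier (Sub (sh E t j) F)" using p by (intro image_eqI[of _ _ "subob p"]) simp_all
  next
    fix p assume "p \<in> chr E t ` carrier (Sub (sh E t j) F)"
    then obtain m where "p = chr E t m" "monic E m" "tgt E m = F" "is_sheaf E t j (src E m)"
      by (auto simp: monic_sh_iff)
    then show "p \<in> {p. pred p \<and> src E p = F \<and> j \<cdot> p = p}"
      using sheaf_subobject_closed[OF F, of m] by simp
  qed
  show "p = q" if "p \<in> {p. pred p \<and> src E p = F \<and> j \<cdot> p = p}" "q \<in> {p. pred p \<and> src E p = F \<and> j \<cdot> p = p}"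
     "p \<preceq> q" "q \<preceq> p" for p q
    using that by (intro leq_antisym) simp_all
qed

text \<open>The pseudocomplement of a closed predicate in the lattice of closed predicates.\<close>

definition neg_j :: "'a \<Rightarrow> 'a" where
  "neg_j p = imp p (j \<cdot> bot (src E p))"

lemma neg_j_simps [simp]:
  assumes "pred p"
  shows "neg_j p \<in> arr E" "src E (neg_j p) = src E p" "tgt E (neg_j p) = \<Omega>" "j \<cdot> neg_j p = neg_j p"
  using assms by (simp_all add: neg_j_def closed_imp)

lemma neg_j_cmp [simp]:
  assumes "pred p" "f \<in> arr E" "tgt E f = src E p"
  shows "neg_j p \<cdot> f = neg_j (p \<cdot> f)"
  using assms by (simp add: neg_j_def)

lemma Sub_sh_top:
  assumes F: "is_sheaf E t j F"
  shows "\<top>\<^bsub>Sub (sh E t j) F\<^esub> \<in> carrier (Sub (sh E t j) F)" "chr E t \<top>\<^bsub>Sub (sh E t j) F\<^esub> = tru F"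
  using order_presentation.top[OF Sub_sh_presentation[OF F], of "tru F"] F by auto

lemma Sub_sh_carrier:
  assumes F: "is_sheaf E t j F" and m: "m \<in> carrier (Sub (sh E t j) F)"
  shows "chr E t m \<in> arr E" "tgt E (chr E t m) = \<Omega>" "src E (chr E t m) = F" "j \<cdot> chr E t m = chr E t m"
  using order_presentation.image_in[OF Sub_sh_presentation[OF F] m] by auto

lemma Sub_sh_join:
  assumes F: "is_sheaf E t j F" and mn: "m \<in> carrier (Sub (sh E t j) F)" "n \<in> carrier (Sub (sh E t j) F)"
  shows "m \<squnion>\<^bsub>Sub (sh E t j) F\<^esub> n \<in> carrier (Sub (sh E t j) F)"
    "chr E t (m \<squnion>\<^bsub>Sub (sh E t j) F\<^esub> n) = j \<cdot> disj (chr E t m) (chr E t n)"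
proof -
  let ?p = "chr E t m" and ?q = "chr E t n"
  have p: "pred ?p" "src E ?p = F" "pred ?q" "src E ?q = F"
    using Sub_sh_carrier[OF F] mn by auto
  have "?p \<preceq> j \<cdot> disj ?p ?q" "?q \<preceq> j \<cdot> disj ?p ?q"
    using p leq_trans[of ?p "disj ?p ?q" "j \<cdot> disj ?p ?q"] leq_trans[of ?q "disj ?p ?q" "j \<cdot> disj ?p ?q"] by simp_all
  moreover have "j \<cdot> disj ?p ?q \<preceq> r" if "pred r" "src E r = F" "j \<cdot> r = r" "?p \<preceq> r" "?q \<preceq> r" for r
    using that p disj_leq[of ?p ?q r] by (intro j_leq_closed) simp_all
  ultimately show "m \<squnion>\<^bsub>Sub (sh E t j) F\<^esub> n \<in> carrier (Sub (sh E t j) F)"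
    "chr E t (m \<squnion>\<^bsub>Sub (sh E t j) F\<^esub> n) = j \<cdot> disj ?p ?q"
    using order_presentation.join[OF Sub_sh_presentation[OF F] mn, of "j \<cdot> disj ?p ?q"] p by simp_all
qed

lemma Sub_sh_pcomp:
  assumes F: "is_sheaf E t j F" and m: "m \<in> carrier (Sub (sh E t j) F)"
  shows "\<sim>\<^bsub>Sub (sh E t j) F\<^esub> m \<in> carrier (Sub (sh E t j) F)"
    "chr E t (\<sim>\<^bsub>Sub (sh E t j) F\<^esub> m) = neg_j (chr E t m)"
proof -
  let ?p = "chr E t m" and ?b = "j \<cdot> bot F"
  have p: "pred ?p" "src E ?p = F" "F \<in> obj E" "j \<cdot> ?p = ?p"
    using Sub_sh_carrier[OF F m] F by auto
  have b: "?b \<preceq> q" if "pred q" "src E q = F" "j \<cdot> q = q" for q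
    using that p by (intro j_leq_closed) simp_all
  have eq: "conj q ?p = ?b \<longleftrightarrow> q \<preceq> neg_j ?p" if q: "pred q" "src E q = F" "j \<cdot> q = q" for q
  proof -
    have "conj q ?p = ?b \<longleftrightarrow> conj q ?p \<preceq> ?b"
      using q p b[of "conj q ?p"] leq_antisym[of "conj q ?p" ?b] by (auto simp: j_conj)
    then show ?thesis using q p by (simp add: neg_j_def leq_imp_iff)
  qed
  show "\<sim>\<^bsub>Sub (sh E t j) F\<^esub> m \<in> carrier (Sub (sh E t j) F)"
    "chr E t (\<sim>\<^bsub>Sub (sh E t j) F\<^esub> m) = neg_j ?p"
    using order_presentation.pcomp[OF Sub_sh_presentation[OF F] m, of ?b "\<lambda>q. conj q ?p" "neg_j ?p"] p eq b
    by (auto simp: leq_conj_iff j_conj)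
qed

lemma Sub_sh_eq_top:
  assumes F: "is_sheaf E t j F" and m: "m \<in> carrier (Sub (sh E t j) F)"
  shows "m .=\<^bsub>Sub (sh E t j) F\<^esub> \<top>\<^bsub>Sub (sh E t j) F\<^esub> \<longleftrightarrow> chr E t m = tru F"
  using order_presentation.eq_iff[OF Sub_sh_presentation[OF F] m Sub_sh_top(1)[OF F]] Sub_sh_top(2)[OF F] by simp

lemma ball_Sub_sh:
  assumes F: "is_sheaf E t j F"
  shows "(\<forall>m\<in>carrier (Sub (sh E t j) F). P (chr E t m)) \<longleftrightarrow> (\<forall>p. pred p \<and> src E p = F \<and> j \<cdot> p = p \<longrightarrow> P p)"
proof -
  have "(\<forall>m\<in>carrier (Sub (sh E t j) F). P (chr E t m)) \<longleftrightarrow>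
      (\<forall>p\<in>chr E t ` carrier (Sub (sh E t j) F). P p)" by blast
  then show ?thesis
    unfolding order_presentation.image[OF Sub_sh_presentation[OF F]] by simp
qed

lemma is_boolean_sh_iff:
  "is_boolean (sh E t j) \<longleftrightarrow>
    (\<forall>p. pred p \<and> is_sheaf E t j (src E p) \<and> j \<cdot> p = p \<longrightarrow> j \<cdot> disj p (neg_j p) = tru (src E p))"
proof -
  have "m \<squnion>\<^bsub>Sub (sh E t j) F\<^esub> (\<sim>\<^bsub>Sub (sh E t j) F\<^esub> m) .=\<^bsub>Sub (sh E t j) F\<^esub> \<top>\<^bsub>Sub (sh E t j) F\<^esub> \<longleftrightarrow>
      j \<cdot> disj (chr E t m) (neg_j (chr E t m)) = tru F"
    if F: "is_sheaf E t j F" and m: "m \<in> carrier (Sub (sh E t j) F)" for F m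
    using Sub_sh_join[OF F m Sub_sh_pcomp(1)[OF F m]] Sub_sh_pcomp(2)[OF F m] by (simp only: Sub_sh_eq_top[OF F])
  then have "is_boolean (sh E t j) \<longleftrightarrow> (\<forall>F. is_sheaf E t j F \<longrightarrow>
      (\<forall>m\<in>carrier (Sub (sh E t j) F). j \<cdot> disj (chr E t m) (neg_j (chr E t m)) = tru F))"
    unfolding is_boolean_def by (simp del: Sub_simps)
  also have "\<dots> \<longleftrightarrow> (\<forall>F. is_sheaf E t j F \<longrightarrow>
      (\<forall>p. pred p \<and> src E p = F \<and> j \<cdot> p = p \<longrightarrow> j \<cdot> disj p (neg_j p) = tru F))"
    using ball_Sub_sh[where P = "\<lambda>p. j \<cdot> disj p (neg_j p) = tru _"] by (simp del: Sub_simps)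
  finally show ?thesis by blast
qed

lemma is_de_morgan_sh_iff:
  "is_de_morgan (sh E t j) \<longleftrightarrow>
    (\<forall>p. pred p \<and> is_sheaf E t j (src E p) \<and> j \<cdot> p = p \<longrightarrow>
      j \<cdot> disj (neg_j p) (neg_j (neg_j p)) = tru (src E p))"
proof -
  have "(\<sim>\<^bsub>Sub (sh E t j) F\<^esub> m) \<squnion>\<^bsub>Sub (sh E t j) F\<^esub> (\<sim>\<^bsub>Sub (sh E t j) F\<^esub> (\<sim>\<^bsub>Sub (sh E t j) F\<^esub> m))
       .=\<^bsub>Sub (sh E t j) F\<^esub> \<top>\<^bsub>Sub (sh E t j) F\<^esub> \<longleftrightarrow>
      j \<cdot> disj (neg_j (chr E t m)) (neg_j (neg_j (chr E t m))) = tru F"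
    if F: "is_sheaf E t j F" and m: "m \<in> carrier (Sub (sh E t j) F)" for F m
    using Sub_sh_join[OF F Sub_sh_pcomp(1)[OF F m] Sub_sh_pcomp(1)[OF F Sub_sh_pcomp(1)[OF F m]]]
      Sub_sh_pcomp(2)[OF F m] Sub_sh_pcomp(2)[OF F Sub_sh_pcomp(1)[OF F m]]
    by (simp only: Sub_sh_eq_top[OF F])
  then have "is_de_morgan (sh E t j) \<longleftrightarrow> (\<forall>F. is_sheaf E t j F \<longrightarrow>
      (\<forall>m\<in>carrier (Sub (sh E t j) F). j \<cdot> disj (neg_j (chr E t m)) (neg_j (neg_j (chr E t m))) = tru F))"
    unfolding is_de_morgan_def by (simp del: Sub_simps)
  also have "\<dots> \<longleftrightarrow> (\<forall>F. is_sheaf E t j F \<longrightarrow>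
      (\<forall>p. pred p \<and> src E p = F \<and> j \<cdot> p = p \<longrightarrow> j \<cdot> disj (neg_j p) (neg_j (neg_j p)) = tru F))"
    using ball_Sub_sh[where P = "\<lambda>p. j \<cdot> disj (neg_j p) (neg_j (neg_j p)) = tru _"] by (simp del: Sub_simps)
  finally show ?thesis by blast
qed

end

section \<open>Weakly open local operators\<close>

locale weakly_open_sheafification = sheafification E t j ao aa \<eta>
  for E :: "('o, 'a) cat" (structure) and t j :: 'a and ao aa \<eta> +
  assumes aa_pcomp: "X \<in> obj E \<Longrightarrow> m \<in> carrier (Sub E X) \<Longrightarrow>
    aa (\<sim>\<^bsub>Sub E X\<^esub> m) .=\<^bsub>Sub (sh E t j) (ao X)\<^esub> \<sim>\<^bsub>Sub (sh E t j) (ao X)\<^esub> (aa m)"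
begin

text \<open>Weak openness read on predicates: restrict the given equality of subobjects of \<open>aX\<close> along \<open>\<eta>\<close>, where
\<open>a(m)\<close> becomes the closure of \<open>m\<close> and \<open>\<not>\<^sub>j\<close> is stable.\<close>

lemma j_neg:
  assumes p: "pred p"
  shows "j \<cdot> neg p = neg_j (j \<cdot> p)"
proof -
  let ?X = "src E p" and ?m = "subob p"
  let ?L = "Sub (sh E t j) (ao ?X)"
  have X: "?X \<in> obj E" and m: "?m \<in> carrier (Sub E ?X)" and F: "is_sheaf E t j (ao ?X)" using p by auto
  have aac: "aa n \<in> carrier ?L" if "n \<in> carrier (Sub E ?X)" for n
    using that aa_monic[of n] X by (auto simp: monic_sh_iff)
  note n = Sub_pcomp[OF m]
  have "chr E t (aa (\<sim>\<^bsub>Sub E ?X\<^esub> ?m)) = chr E t (\<sim>\<^bsub>?L\<^esub> (aa ?m))"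
    using aa_pcomp[OF X m] order_presentation.eq_iff[OF Sub_sh_presentation[OF F] aac[OF n(1)]
        Sub_sh_pcomp(1)[OF F aac[OF m]]] by blast
  then have eq: "chr E t (aa (\<sim>\<^bsub>Sub E ?X\<^esub> ?m)) = neg_j (chr E t (aa ?m))"
    using Sub_sh_pcomp(2)[OF F aac[OF m]] by simp
  have "j \<cdot> neg p = chr E t (aa (\<sim>\<^bsub>Sub E ?X\<^esub> ?m)) \<cdot> \<eta> ?X"
    using chr_aa(2)[of "\<sim>\<^bsub>Sub E ?X\<^esub> ?m"] n p by simp
  also have "\<dots> = neg_j (chr E t (aa ?m) \<cdot> \<eta> ?X)"
    unfolding eq using p X aa_monic[of ?m] by simp
  also have "\<dots> = neg_j (j \<cdot> p)"
    using chr_aa(2)[of ?m] p by simp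
  finally show ?thesis .
qed

lemma neg_j_closed: "pred p \<Longrightarrow> j \<cdot> p = p \<Longrightarrow> neg_j p = j \<cdot> neg p"
  using j_neg[of p] by simp

lemma neg_leq_neg_j:
  assumes "pred p"
  shows "neg p \<preceq> neg_j p"
proof -
  have "conj (neg p) p \<preceq> j \<cdot> bot (src E p)"
    by (rule leq_trans[OF conj_neg]) (use assms in simp_all)
  then show ?thesis using assms by (simp add: neg_j_def leq_imp_iff)
qed

text \<open>Reflecting Booleanness back to arbitrary objects is where weak openness enters: on \<open>X\<close>, the
transported law \<open>j(jp \<or> \<not>\<^sub>j(jp)) = \<top>\<close> becomes a statement about \<open>\<not>p\<close>.\<close>

lemma boolean_iff: "lop_le E t (boolean_topology E t) j \<longleftrightarrow> is_boolean (sh E t j)"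
proof
  assume le: "lop_le E t (boolean_topology E t) j"
  have le: "neg (neg p) \<preceq> j \<cdot> p" if "pred p" for p
    using le that by (simp add: lop_le_iff boolean_topology_simps boolean_topology_cmp)
  show "is_boolean (sh E t j)"
    unfolding is_boolean_sh_iff
  proof (intro allI impI)
    fix p assume "pred p \<and> is_sheaf E t j (src E p) \<and> j \<cdot> p = p"
    then have p: "pred p" "j \<cdot> p = p" by auto
    have "tru (src E p) \<preceq> j \<cdot> disj p (neg p)"
      using le[of "disj p (neg p)"] p by (simp add: neg_neg_disj_neg)
    moreover have "disj p (neg p) \<preceq> disj p (neg_j p)"
      using p leq_trans[OF neg_leq_neg_j, of p "disj p (neg_j p)"] by (intro disj_leq) simp_all
    then have "j \<cdot> disj p (neg p) \<preceq> j \<cdot> disj p (neg_j p)" using p by (intro j_mono) simp_all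
    ultimately have "tru (src E p) \<preceq> j \<cdot> disj p (neg_j p)"
      using p leq_trans[of "tru (src E p)" "j \<cdot> disj p (neg p)"] by simp
    then show "j \<cdot> disj p (neg_j p) = tru (src E p)" using p by (intro tru_leq) simp_all
  qed
next
  assume bool: "is_boolean (sh E t j)"
  have "neg (neg p) \<preceq> j \<cdot> p" if p: "pred p" for p
  proof -
    let ?X = "src E p"
    have X: "?X \<in> obj E" using p by simp
    obtain q where q: "pred q" "src E q = ao ?X" "j \<cdot> q = q" "q \<cdot> \<eta> ?X = j \<cdot> p"
      using closed_transfer[of "j \<cdot> p"] p by auto
    have "j \<cdot> disj q (neg_j q) = tru (ao ?X)"
      using bool q X unfolding is_boolean_sh_iff by simp
    from cmp_extend[OF this, of "\<eta> ?X"]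
    have top: "j \<cdot> disj (j \<cdot> p) (j \<cdot> neg p) = tru ?X"
      using q X p by (simp add: j_neg)
    \<comment> \<open>A closed upper bound of both disjuncts, true by \<open>top\<close>.\<close>
    let ?i = "imp (neg (neg p)) (j \<cdot> p)"
    have "j \<cdot> p \<preceq> ?i" using p by (simp add: leq_imp_iff)
    moreover have "j \<cdot> neg p \<preceq> ?i"
    proof -
      have "conj (j \<cdot> neg p) (neg (neg p)) \<preceq> conj (j \<cdot> neg p) (j \<cdot> neg (neg p))"
        using p leq_trans[of "conj (j \<cdot> neg p) (neg (neg p))" "neg (neg p)" "j \<cdot> neg (neg p)"]
        by (simp add: leq_conj_iff)
      also have "conj (j \<cdot> neg p) (j \<cdot> neg (neg p)) = j \<cdot> conj (neg (neg p)) (neg p)"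
        using p by (simp add: conj_commute[of "neg (neg p)"] j_conj)
      finally have 1: "conj (j \<cdot> neg p) (neg (neg p)) \<preceq> j \<cdot> conj (neg (neg p)) (neg p)" .
      have "conj (neg (neg p)) (neg p) \<preceq> p"
        using p conj_neg[of "neg p"] leq_trans[of "conj (neg (neg p)) (neg p)" "bot ?X" p] by simp
      then have "j \<cdot> conj (neg (neg p)) (neg p) \<preceq> j \<cdot> p" using p by (intro j_mono) simp_all
      with 1 have "conj (j \<cdot> neg p) (neg (neg p)) \<preceq> j \<cdot> p"
        using p leq_trans[of "conj (j \<cdot> neg p) (neg (neg p))"] by simp
      then show ?thesis using p by (simp add: leq_imp_iff)
    qed
    ultimately have "disj (j \<cdot> p) (j \<cdot> neg p) \<preceq> ?i" using p by (intro disj_leq) simp_all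
    then have "tru ?X \<preceq> ?i"
      using p j_leq_closed[of "disj (j \<cdot> p) (j \<cdot> neg p)" ?i] by (simp add: top closed_imp)
    then have "conj (tru ?X) (neg (neg p)) \<preceq> j \<cdot> p" using p X by (simp add: leq_imp_iff)
    moreover have "neg (neg p) \<preceq> conj (tru ?X) (neg (neg p))" using p X by (simp add: leq_conj_iff)
    ultimately show ?thesis using p X leq_trans[of "neg (neg p)"] by simp
  qed
  then show "lop_le E t (boolean_topology E t) j"
    by (simp add: lop_le_iff boolean_topology_simps boolean_topology_cmp)
qed

text \<open>By \<open>j_neg\<close>, \<open>\<not>\<^sub>j\<not>\<^sub>j(jp) = j(\<not>\<not>p)\<close>, so the law for sheaves and the density of all \<open>\<not>p \<or> \<not>\<not>p\<close> are the
same condition on \<open>j\<close>; the minimality of \<open>k\<close> turns density into \<open>k \<le> j\<close>.\<close>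

lemma de_morgan_iff:
  assumes k: "is_de_morgan_topology E t k"
  shows "lop_le E t k j \<longleftrightarrow> is_de_morgan (sh E t j)"
proof
  interpret k: local_op E t k
    using k by unfold_locales (simp add: is_de_morgan_topology_def)
  assume le: "lop_le E t k j"
  have le: "k \<cdot> p \<preceq> j \<cdot> p" if "pred p" for p
    using le that by (simp add: lop_le_iff)
  have kd: "k \<cdot> disj (neg p) (neg (neg p)) = tru (src E p)" if "pred p" for p
    using k that k.de_morgan_dense_iff by (simp add: is_de_morgan_topology_def)
  show "is_de_morgan (sh E t j)"
    unfolding is_de_morgan_sh_iff
  proof (intro allI impI)
    fix p assume "pred p \<and> is_sheaf E t j (src E p) \<and> j \<cdot> p = p"
    then have p: "pred p" "j \<cdot> p = p" by auto
    have 1: "tru (src E p) \<preceq> j \<cdot> disj (neg p) (neg (neg p))"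
      using le[of "disj (neg p) (neg (neg p))"] p by (simp add: kd)
    have nn: "neg_j (neg_j p) = j \<cdot> neg (neg p)"
      using p neg_j_closed[OF p] j_neg[of "neg p"] by simp
    have a: "neg p \<preceq> disj (neg_j p) (neg_j (neg_j p))"
      by (rule leq_trans[OF neg_leq_neg_j]) (use p in simp_all)
    have b: "neg (neg p) \<preceq> disj (neg_j p) (neg_j (neg_j p))"
    proof (rule leq_trans)
      show "neg (neg p) \<preceq> neg_j (neg_j p)" unfolding nn using p by simp
    qed (use p in simp_all)
    have "disj (neg p) (neg (neg p)) \<preceq> disj (neg_j p) (neg_j (neg_j p))"
      using p a b by (intro disj_leq) simp_all
    then have "j \<cdot> disj (neg p) (neg (neg p)) \<preceq> j \<cdot> disj (neg_j p) (neg_j (neg_j p))"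
      using p by (intro j_mono) simp_all
    with 1 have "tru (src E p) \<preceq> j \<cdot> disj (neg_j p) (neg_j (neg_j p))"
      using p leq_trans[of "tru (src E p)" "j \<cdot> disj (neg p) (neg (neg p))"] by simp
    then show "j \<cdot> disj (neg_j p) (neg_j (neg_j p)) = tru (src E p)"
      using p by (intro tru_leq) simp_all
  qed
next
  assume dm: "is_de_morgan (sh E t j)"
  have "j \<cdot> disj (neg p) (neg (neg p)) = tru (src E p)" if p: "pred p" for p
  proof -
    let ?X = "src E p"
    have X: "?X \<in> obj E" using p by simp
    obtain q where q: "pred q" "src E q = ao ?X" "j \<cdot> q = q" "q \<cdot> \<eta> ?X = j \<cdot> p"
      using closed_transfer[of "j \<cdot> p"] p by auto
    have "j \<cdot> disj (neg_j q) (neg_j (neg_j q)) = tru (ao ?X)"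
      using dm q X unfolding is_de_morgan_sh_iff by simp
    from cmp_extend[OF this, of "\<eta> ?X"]
    have top: "j \<cdot> disj (j \<cdot> neg p) (j \<cdot> neg (neg p)) = tru ?X"
      using q X p by (simp flip: j_neg)
    have "disj (j \<cdot> neg p) (j \<cdot> neg (neg p)) \<preceq> j \<cdot> disj (neg p) (neg (neg p))"
      using p by (intro disj_leq j_mono) simp_all
    then have "tru ?X \<preceq> j \<cdot> disj (neg p) (neg (neg p))"
      using p j_leq_closed[of "disj (j \<cdot> neg p) (j \<cdot> neg (neg p))" "j \<cdot> disj (neg p) (neg (neg p))"]
      by (simp add: top)
    then show ?thesis using p by (intro tru_leq) simp_all
  qed
  then have "de_morgan_dense E t j" by (simp add: de_morgan_dense_iff)
  then show "lop_le E t k j" using k local_operator by (simp add: is_de_morgan_topology_def)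
qed

end

theorem proposition4p1:
  fixes E :: "('o, 'a) cat" and t j :: 'a
  assumes "elementary_topos E"
    and "subobject_classifier E t"
    and "local_operator E t j"
    and "weakly_open E t j"
  shows "(lop_le E t (boolean_topology E t) j \<longleftrightarrow> is_boolean (sh E t j)) \<and>
         (\<forall>k. is_de_morgan_topology E t k \<longrightarrow>
            (lop_le E t k j \<longleftrightarrow> is_de_morgan (sh E t j)))"
proof -
  obtain ao aa \<eta> where "associated_sheaf_functor E t j ao aa \<eta>"
    and "\<And>X m. X \<in> obj E \<Longrightarrow> m \<in> carrier (Sub E X) \<Longrightarrow>
           aa (\<sim>\<^bsub>Sub E X\<^esub> m) .=\<^bsub>Sub (sh E t j) (ao X)\<^esub> \<sim>\<^bsub>Sub (sh E t j) (ao X)\<^esub> (aa m)"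
    using assms(4) unfolding weakly_open_def by blast
  then interpret weakly_open_sheafification E t j ao aa \<eta>
    using assms by unfold_locales
  show ?thesis using boolean_iff de_morgan_iff by blast
qed

end
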